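(* Suppose that $a,b>0$, $\alpha^-\in\mathcal A_+^{m^-}$ and $\alpha^+\in\mathcal A_+^{m^+}$. For each integer $k\ge 1$ and each $\nu\in\{\pm\}$ there is exactly one half-eigenvalue $\lambda_{k,\nu}=\lambda_{k,\nu}(a,b)>0$ of the problem $$-u''=\lambda(au^+-bu^-)\ \text{ on }(-1,1),\qquad u\in X,$$ having a half-eigenfunction $u_{k,\nu}=u_{k,\nu}(a,b)\in T_{k,\nu}$, and there are no other half-eigenvalues. The sequence of half-eigenvalues is strictly increasing, in the sense that $$k'>k\implies \lambda_{k',\nu'}>\lambda_{k,\nu},\qquad\text{for each }\nu',\nu\in\{\pm\}.$$ In addition, $\pm u_{1,\pm}$ is strictly positive on $(-1,1)$, and $\lim_{k\to\infty}\lambda_{k,\pm}=\infty$.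
   Context: For an integer $m\ge1$, $\mathcal A_+^m$ is the set of $\alpha\in\mathbb R^m$ with $\alpha_i\ge0$ for all $i$ and $\sum_{i=1}^m\alpha_i<1$. Fixed data: integers $m^\pm\ge1$, coefficients $\alpha^\pm\in\mathcal A_+^{m^\pm}$ and points $\eta^\pm\in(-1,1)^{m^\pm}$. The multi-point Dirichlet-type boundary conditions are $u(\pm1)=\sum_{i=1}^{m^\pm}\alpha_i^\pm u(\eta_i^\pm)$ (one condition at $-1$, one at $+1$), and $X:=\{u\in C^2[-1,1]: u \text{ satisfies both boundary conditions}\}$. Write $u^\pm(x)=\max\{\pm u(x),0\}$. Given $a,b>0$, a number $\lambda\in\mathbb R$ is a half-eigenvalue if the problem $-u''=\lambda(au^+-bu^-)$ on $(-1,1)$, $u\in X$, has a non-trivial solution $u$; such a $u$ is then called a half-eigenfunction. A zero $x_0$ of a $C^1$ function $v$ is simple if $v'(x_0)\neq0$. For $k\ge1$ and $\nu\in\{\pm\}$, $T_{k,\nu}\subset X$ is the set of $u\in X$ such that: (a) $u'(\pm1)\ne0$ and $\nu u'(-1)>0$; (b) $u'$ has only simple zeros in $(-1,1)$, and has exactly $k$ such zeros; (c) $u$ has a zero strictly between each pair of consecutive zeros of $u'$. *)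

theory Defs
  imports "HOL-Analysis.Analysis"
begin

text \<open>
  Elements of \<open>C\<^sup>2[-1,1]\<close> are represented by total functions \<open>real \<Rightarrow> real\<close> of which only the
  restriction to \<open>[-1,1]\<close> matters. Accordingly derivatives are taken within \<open>[-1,1]\<close>: they are
  one-sided at the end points and the usual ones in the interior.
\<close>

definition dI :: "(real \<Rightarrow> real) \<Rightarrow> real \<Rightarrow> real" where
  "dI u x = vector_derivative u (at x within {-1..1})"

definition C2_I :: "(real \<Rightarrow> real) set" where
  "C2_I = {u. u differentiable_on {-1..1} \<and> dI u differentiable_on {-1..1}
              \<and> continuous_on {-1..1} (dI (dI u))}"

definition A_plus :: "(real ^ 'm) set" where
  "A_plus = {\<alpha>. (\<forall>i. 0 \<le> \<alpha> $ i) \<and> (\<Sum>i\<in>UNIV. \<alpha> $ i) < 1}"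

text \<open>
  In the argument lists below \<open>\<alpha>m \<eta>m\<close> are the coefficients and points of the condition at \<open>-1\<close>,
  and \<open>\<alpha>p \<eta>p\<close> those of the condition at \<open>1\<close>.
\<close>

definition X_space ::
  "real ^ 'm \<Rightarrow> real ^ 'm \<Rightarrow> real ^ 'p \<Rightarrow> real ^ 'p \<Rightarrow> (real \<Rightarrow> real) set" where
  "X_space \<alpha>m \<eta>m \<alpha>p \<eta>p =
     {u \<in> C2_I. u (-1) = (\<Sum>i\<in>UNIV. \<alpha>m $ i * u (\<eta>m $ i))
              \<and> u 1 = (\<Sum>i\<in>UNIV. \<alpha>p $ i * u (\<eta>p $ i))}"

definition half_eigenfunction ::
  "real ^ 'm \<Rightarrow> real ^ 'm \<Rightarrow> real ^ 'p \<Rightarrow> real ^ 'p \<Rightarrow> real \<Rightarrow> real \<Rightarrow> real \<Rightarrow> (real \<Rightarrow> real) \<Rightarrow> bool"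
  where
  "half_eigenfunction \<alpha>m \<eta>m \<alpha>p \<eta>p a b lam u \<longleftrightarrow>
     u \<in> X_space \<alpha>m \<eta>m \<alpha>p \<eta>p
     \<and> (\<exists>x\<in>{-1..1}. u x \<noteq> 0)
     \<and> (\<forall>x\<in>{-1<..<1}. - dI (dI u) x = lam * (a * max (u x) 0 - b * max (- u x) 0))"

definition half_eigenvalue ::
  "real ^ 'm \<Rightarrow> real ^ 'm \<Rightarrow> real ^ 'p \<Rightarrow> real ^ 'p \<Rightarrow> real \<Rightarrow> real \<Rightarrow> real \<Rightarrow> bool" where
  "half_eigenvalue \<alpha>m \<eta>m \<alpha>p \<eta>p a b lam \<longleftrightarrow>
     (\<exists>u. half_eigenfunction \<alpha>m \<eta>m \<alpha>p \<eta>p a b lam u)"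

definition simple_zero :: "(real \<Rightarrow> real) \<Rightarrow> real \<Rightarrow> bool" where
  "simple_zero v x \<longleftrightarrow> v x = 0 \<and> dI v x \<noteq> 0"

definition interior_zeros :: "(real \<Rightarrow> real) \<Rightarrow> real set" where
  "interior_zeros v = {x \<in> {-1<..<1}. v x = 0}"

text \<open>The sign \<open>\<nu>\<close> is encoded as one of the real numbers \<open>1\<close> and \<open>-1\<close>.\<close>

definition T_set ::
  "real ^ 'm \<Rightarrow> real ^ 'm \<Rightarrow> real ^ 'p \<Rightarrow> real ^ 'p \<Rightarrow> nat \<Rightarrow> real \<Rightarrow> (real \<Rightarrow> real) set" where
  "T_set \<alpha>m \<eta>m \<alpha>p \<eta>p k \<nu> =
     {u \<in> X_space \<alpha>m \<eta>m \<alpha>p \<eta>p.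
        dI u (-1) \<noteq> 0 \<and> dI u 1 \<noteq> 0 \<and> \<nu> * dI u (-1) > 0
      \<and> (\<forall>x\<in>interior_zeros (dI u). simple_zero (dI u) x)
      \<and> finite (interior_zeros (dI u)) \<and> card (interior_zeros (dI u)) = k
      \<and> (\<forall>x\<in>interior_zeros (dI u). \<forall>y\<in>interior_zeros (dI u).
            x < y \<and> {x<..<y} \<inter> interior_zeros (dI u) = {} \<longrightarrow> (\<exists>z\<in>{x<..<y}. u z = 0))}"

end

theory Submission
  imports Defs
begin

text \<open>
  For \<open>\<lambda> \<le> 0\<close> a maximum principle excludes non-trivial solutions. For \<open>\<lambda> > 0\<close> every solution is
  \<open>C \<phi>(t)\<close> with \<open>C > 0\<close>, where \<open>\<phi>\<close> is one fixed periodic solution of \<open>\<phi>'' = -(a \<phi>\<^sup>+ - b \<phi>\<^sup>-)\<close> with energy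
  \<open>\<phi>'\<^sup>2 + a (\<phi>\<^sup>+)\<^sup>2 + b (\<phi>\<^sup>-)\<^sup>2 = 1\<close> and \<open>t\<close> runs affinely from a phase \<open>p\<close> to a phase \<open>q = p + 2 \<surd>\<lambda>\<close>.
  The boundary conditions become two equations for \<open>(p, q)\<close>. The energy identity and \<open>\<Sum>\<alpha>\<^sub>i < 1\<close> show that
  at a zero of either equation the derivative of the left-hand side \<open>\<phi>\<close> strictly dominates the
  derivatives of the right-hand side. Hence, with \<open>p\<close> confined to an interval between two consecutive
  critical points of \<open>\<phi>\<close>, the first equation defines \<open>p\<close> as a strictly contracting function of \<open>q\<close>,
  and likewise for the second. So each pair of such intervals contains exactly one solution
  \<open>(p, q)\<close>; the number of critical points between \<open>p\<close> and \<open>q\<close> is \<open>k\<close>, the sign of \<open>\<phi>'(p)\<close> is \<open>\<nu>\<close>, and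
  contractivity also yields the monotonicity of \<open>q - p\<close> in \<open>k\<close>.
\<close>

section \<open>Preliminaries\<close>

text \<open>Value and slope agree at \<open>c\<close>, so the pieces glue differentiably; this joins
  the two arches of the oscillator.\<close>

lemma DERIV_If_le:
  fixes f g f' g' :: "real \<Rightarrow> real"
  assumes "\<And>t. (f has_real_derivative f' t) (at t)" "\<And>t. (g has_real_derivative g' t) (at t)"
    and "f c = g c" "f' c = g' c"
  shows "((\<lambda>x. if x \<le> c then f x else g x) has_real_derivative (if t \<le> c then f' t else g' t)) (at t)"
proof -
  have "((\<lambda>x. if x \<in> {..c} then f x else g x) has_vector_derivative
      (if t \<in> {..c} then f' t else g' t)) (at t within UNIV)"
    using assms
    by (intro has_vector_derivative_If_within_closures[where T = "{c<..}"])
       (auto simp flip: has_real_derivative_iff_has_vector_derivative intro: has_field_derivative_at_within)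
  then show ?thesis
    by (simp add: has_real_derivative_iff_has_vector_derivative)
qed

text \<open>Each \<open>(X i, Y i)\<close> lies in the unit disc, so its inner product with the unit
  vector \<open>(x, y)\<close> is at most 1, as the squared distance of the two vectors
  shows.\<close>

lemma convex_sum_unit_le:
  fixes x y :: real
  assumes "x\<^sup>2 + y\<^sup>2 = 1" "\<And>i. i \<in> I \<Longrightarrow> 0 \<le> w i"
    and "\<And>i. i \<in> I \<Longrightarrow> (X i)\<^sup>2 + (Y i)\<^sup>2 \<le> 1"
  shows "x * (\<Sum>i\<in>I. w i * X i) + y * (\<Sum>i\<in>I. w i * Y i) \<le> sum w I"
proof -
  have "x * (\<Sum>i\<in>I. w i * X i) + y * (\<Sum>i\<in>I. w i * Y i) = (\<Sum>i\<in>I. w i * (x * X i + y * Y i))"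
    by (simp add: sum_distrib_left sum.distrib algebra_simps)
  also have "\<dots> \<le> (\<Sum>i\<in>I. w i * 1)"
  proof (intro sum_mono mult_left_mono)
    fix i assume i: "i \<in> I"
    have "0 \<le> (x - X i)\<^sup>2 + (y - Y i)\<^sup>2" by simp
    also have "\<dots> \<le> 2 - 2 * (x * X i + y * Y i)"
      using assms(1) assms(3)[OF i] by (simp add: power2_diff)
    finally show "x * X i + y * Y i \<le> 1" by simp
    show "0 \<le> w i" using assms(2) i .
  qed
  finally show ?thesis by simp
qed

text \<open>An upward crossing at \<open>u\<close> makes \<open>K\<close> positive just after
  \<open>u\<close>; at the next zero \<open>K\<close> would come from positive values, which an
  upward crossing forbids.\<close>

lemma no_two_upcrossings:
  fixes K :: "real \<Rightarrow> real"
  assumes K: "\<And>t. t \<in> {u..v} \<Longrightarrow> (K has_real_derivative K' t) (at t)"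
    and up: "\<And>t. t \<in> {u..v} \<Longrightarrow> K t = 0 \<Longrightarrow> 0 < K' t"
    and uv: "u < v" "K u = 0" "K v = 0"
  shows False
proof -
  have cont: "continuous_on {u..v} K"
    using K by (meson DERIV_continuous_on has_field_derivative_at_within)
  obtain d where d: "d > 0" "\<And>h. 0 < h \<Longrightarrow> h < d \<Longrightarrow> 0 < K (u + h)"
    using DERIV_pos_inc_right[OF K[of u] up[of u]] uv by auto
  \<comment> \<open>\<open>K\<close> is positive on \<open>(u, w]\<close>, so the zeros in
    \<open>[w, v]\<close> have a least element, and it exceeds \<open>w\<close>.\<close>
  define w where "w = u + min d (v - u) / 2"
  have w: "u < w" "w < v" "w < u + d"
    using d(1) uv(1) by (auto simp: w_def min_def field_simps)
  have pos: "0 < K t" if "u < t" "t \<le> w" for t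
    using d(2)[of "t - u"] that w by auto
  define Z where "Z = {t \<in> {w..v}. K t = 0}"
  have "closed Z"
    unfolding Z_def
    by (intro continuous_closed_preimage_constant continuous_on_subset[OF cont]) (use w in auto)
  moreover have "v \<in> Z" "bdd_below Z" using uv w by (auto simp: Z_def)
  ultimately have z: "Inf Z \<in> Z" using closed_contains_Inf by blast
  define z where "z = Inf Z"
  have z: "z \<in> {w..v}" "K z = 0" using z by (auto simp: z_def Z_def)
  have "w < z" using pos[of z] z w by force
  obtain e where e: "e > 0" "\<And>h. 0 < h \<Longrightarrow> h < e \<Longrightarrow> K (z - h) < 0"
    using DERIV_pos_inc_left[OF K[of z] up[of z]] z w by auto
  define y where "y = z - min e (z - w) / 2"
  have y: "w < y" "y < z" "z < y + e"
    using e(1) \<open>w < z\<close> by (auto simp: y_def min_def field_simps)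
  have "K y < 0" using e(2)[of "z - y"] y by auto
  \<comment> \<open>The sign change between \<open>w\<close> and \<open>y\<close> produces a zero
    before the first one.\<close>
  have "\<exists>x\<ge>w. x \<le> y \<and> K x = 0"
    using pos[of w] w y z \<open>K y < 0\<close>
    by (intro IVT2' continuous_on_subset[OF cont]) auto
  then obtain x where "x \<in> Z" "x < z" using y z by (auto simp: Z_def)
  then show False using cInf_lower[OF _ \<open>bdd_below Z\<close>] z_def by fastforce
qed

section \<open>Derivatives within \<open>[-1,1]\<close>\<close>

lemma DERIV_within_I_unique:
  assumes "x \<in> {-1..1}" "(u has_real_derivative D) (at x within {-1..1})"
  shows "dI u x = D"
  using vector_derivative_within_cbox[of "-1" 1 x u D] assms
  by (simp add: dI_def has_real_derivative_iff_has_vector_derivative)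

text \<open>Only the values of \<open>u\<close> on \<open>[-1,1]\<close> matter, so a global formula
  \<open>f\<close> may replace it; the two-sided derivative of \<open>f\<close> covers the end
  points as well.\<close>

lemma dI_eqI:
  assumes "x \<in> {-1..1}" "\<And>t. t \<in> {-1..1} \<Longrightarrow> u t = f t" "(f has_real_derivative D) (at x)"
  shows "(u has_real_derivative D) (at x within {-1..1})" "dI u x = D"
proof -
  have "(f has_vector_derivative D) (at x within {-1..1})"
    using assms(3) by (simp add: has_field_derivative_at_within flip: has_real_derivative_iff_has_vector_derivative)
  then have "(u has_vector_derivative D) (at x within {-1..1})"
    using has_vector_derivative_transform[of x "{-1..1}" u f D] assms(1,2) by blast
  then show "(u has_real_derivative D) (at x within {-1..1})"
    by (simp add: has_real_derivative_iff_has_vector_derivative)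
  with assms(1) show "dI u x = D" by (intro DERIV_within_I_unique)
qed

lemma differentiable_on_I_DERIV:
  assumes "u differentiable_on {-1..1}" "x \<in> {-1..1}"
  shows "(u has_real_derivative dI u x) (at x within {-1..1})"
proof -
  obtain D where "(u has_real_derivative D) (at x within {-1..1})"
    using assms unfolding differentiable_on_def real_differentiable_def by blast
  with DERIV_within_I_unique[OF assms(2)] show ?thesis by simp
qed

lemma DERIV_interior:
  assumes "u differentiable_on {-1..1}" "x \<in> {-1<..<1}"
  shows "(u has_real_derivative dI u x) (at x)"
  using differentiable_on_I_DERIV[of u x] assms at_within_interior[of x "{-1..1::real}"]
  by (simp add: interior_atLeastAtMost_real)

lemma C2_I_facts:
  assumes "u \<in> C2_I"
  shows "continuous_on {-1..1} u" "continuous_on {-1..1} (dI u)"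
    and "x \<in> {-1<..<1} \<Longrightarrow> (u has_real_derivative dI u x) (at x)"
    and "x \<in> {-1<..<1} \<Longrightarrow> (dI u has_real_derivative dI (dI u) x) (at x)"
  using assms DERIV_interior differentiable_imp_continuous_on by (auto simp: C2_I_def)

text \<open>Gronwall argument for the difference \<open>w\<close>: by the Lipschitz bound, the
  squared norm of \<open>(w, w')\<close> grows at rate at most \<open>1 + L\<close>. So the weighted
  quantity \<open>E\<close> does not increase; it is nonnegative and starts at 0.\<close>

lemma second_order_ode_unique:
  fixes F :: "real \<Rightarrow> real"
  assumes cont: "continuous_on {-1..1} u" "continuous_on {-1..1} v"
      "continuous_on {-1..1} u'" "continuous_on {-1..1} v'"
    and der: "\<And>x. x \<in> {-1<..<1} \<Longrightarrow> (u has_real_derivative u' x) (at x)"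
      "\<And>x. x \<in> {-1<..<1} \<Longrightarrow> (v has_real_derivative v' x) (at x)"
      "\<And>x. x \<in> {-1<..<1} \<Longrightarrow> (u' has_real_derivative F (u x)) (at x)"
      "\<And>x. x \<in> {-1<..<1} \<Longrightarrow> (v' has_real_derivative F (v x)) (at x)"
    and lip: "\<And>y z. \<bar>F y - F z\<bar> \<le> L * \<bar>y - z\<bar>"
    and init: "u (-1) = v (-1)" "u' (-1) = v' (-1)"
    and x: "x \<in> {-1..1}"
  shows "u x = v x"
proof -
  define w where "w t = u t - v t" for t
  define w' where "w' t = u' t - v' t" for t
  define E where "E t = ((w t)\<^sup>2 + (w' t)\<^sup>2) * exp (- (1 + L) * t)" for t
  have "E x \<le> E (-1)"
  proof (rule DERIV_nonpos_imp_decreasing_open[of "-1" x])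
    show "-1 \<le> x" using x by simp
    show "continuous_on {-1..x} E"
      unfolding E_def w_def w'_def using x
      by (intro continuous_intros cont[THEN continuous_on_subset]) auto
    fix t assume "-1 < t" "t < x"
    then have t: "t \<in> {-1<..<1}" using x by auto
    define D where "D = F (u t) - F (v t)"
    have dw: "(w has_real_derivative w' t) (at t)" "(w' has_real_derivative D) (at t)"
      unfolding w_def w'_def D_def using der[OF t] by (auto intro: DERIV_diff)
    have "(E has_real_derivative (2 * w t * w' t + 2 * w' t * D
        - (1 + L) * ((w t)\<^sup>2 + (w' t)\<^sup>2)) * exp (- (1 + L) * t)) (at t)"
      unfolding E_def using dw
      by (auto intro!: derivative_eq_intros simp: algebra_simps)
    moreover have "2 * w t * w' t + 2 * w' t * D \<le> (1 + L) * ((w t)\<^sup>2 + (w' t)\<^sup>2)"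
    proof -
      have L: "0 \<le> L" using lip[of 0 1] by simp
      have am: "2 * (\<bar>w t\<bar> * \<bar>w' t\<bar>) \<le> (w t)\<^sup>2 + (w' t)\<^sup>2"
        using sum_squares_bound[of "\<bar>w t\<bar>" "\<bar>w' t\<bar>"] by simp
      have "w' t * D \<le> \<bar>w' t\<bar> * \<bar>D\<bar>" by (metis abs_ge_self abs_mult)
      also have "\<dots> \<le> \<bar>w' t\<bar> * (L * \<bar>w t\<bar>)" 
        using lip[of "u t" "v t"] by (intro mult_left_mono) (auto simp: D_def w_def)
      finally have "2 * (w' t * D) \<le> L * (2 * (\<bar>w t\<bar> * \<bar>w' t\<bar>))" by (simp add: mult_ac)
      also have "\<dots> \<le> L * ((w t)\<^sup>2 + (w' t)\<^sup>2)" using am L by (rule mult_left_mono)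
      finally have "2 * (w' t * D) \<le> L * ((w t)\<^sup>2 + (w' t)\<^sup>2)" .
      moreover have "2 * (w t * w' t) \<le> (w t)\<^sup>2 + (w' t)\<^sup>2"
        using sum_squares_bound[of "w t" "w' t"] by simp
      ultimately show ?thesis by (simp add: algebra_simps)
    qed
    ultimately show "\<exists>y. (E has_real_derivative y) (at t) \<and> y \<le> 0"
      by (intro exI conjI) (assumption, simp add: mult_le_0_iff)
  qed
  also have "E (-1) = 0" using init by (simp add: E_def w_def w'_def)
  finally have "(w x)\<^sup>2 + (w' x)\<^sup>2 \<le> 0" by (simp add: E_def mult_le_0_iff not_le[symmetric])
  then show ?thesis by (simp add: w_def sum_power2_le_zero_iff)
qed

section \<open>Maximum principle and positivity under multi-point conditions\<close>

lemma A_plus_sum_less: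
  assumes "\<alpha> \<in> A_plus" "0 < M" "\<And>i. f i \<le> M"
  shows "(\<Sum>i\<in>UNIV. \<alpha> $ i * f i) < (M :: real)"
proof -
  have "(\<Sum>i\<in>UNIV. \<alpha> $ i * f i) \<le> (\<Sum>i\<in>UNIV. \<alpha> $ i * M)"
    using assms by (intro sum_mono mult_left_mono) (auto simp: A_plus_def)
  also have "\<dots> = (\<Sum>i\<in>UNIV. \<alpha> $ i) * M" by (simp add: sum_distrib_right)
  also have "\<dots> < 1 * M" using assms by (intro mult_strict_right_mono) (auto simp: A_plus_def)
  finally show ?thesis by simp
qed

text \<open>Weights of total below 1 keep a positive maximum away from the end points. At the
  rightmost maximum point the derivative vanishes, and convexity prevents \<open>u\<close> from
  decreasing to its right, so the maximum would be attained further right.\<close>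

lemma multipoint_max_principle:
  fixes \<alpha>m \<eta>m :: "real ^ 'm" and \<alpha>p \<eta>p :: "real ^ 'p"
  assumes cont: "continuous_on {-1..1} u"
    and der: "\<And>x. x \<in> {-1<..<1} \<Longrightarrow> (u has_real_derivative u' x) (at x)"
      "\<And>x. x \<in> {-1<..<1} \<Longrightarrow> (u' has_real_derivative u'' x) (at x)"
    and convex: "\<And>x. x \<in> {-1<..<1} \<Longrightarrow> u x > 0 \<Longrightarrow> u'' x \<ge> 0"
    and A: "\<alpha>m \<in> A_plus" "\<alpha>p \<in> A_plus"
    and \<eta>: "\<And>i. \<eta>m $ i \<in> {-1<..<1}" "\<And>i. \<eta>p $ i \<in> {-1<..<1}"
    and bc: "u (-1) = (\<Sum>i\<in>UNIV. \<alpha>m $ i * u (\<eta>m $ i))" "u 1 = (\<Sum>i\<in>UNIV. \<alpha>p $ i * u (\<eta>p $ i))"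
    and x: "x \<in> {-1..1}"
  shows "u x \<le> 0"
proof (rule ccontr)
  assume "\<not> u x \<le> 0"
  obtain y where y: "y \<in> {-1..1}" "\<And>t. t \<in> {-1..1} \<Longrightarrow> u t \<le> u y"
    using continuous_attains_sup[of "{-1..1}" u] cont by fastforce
  define M where "M = u y"
  have M: "M > 0" using y(2)[OF x] \<open>\<not> u x \<le> 0\<close> by (simp add: M_def)
  have le: "u t \<le> M" if "t \<in> {-1..1}" for t using y(2)[OF that] by (simp add: M_def)
  have "u (\<eta>m $ i) \<le> M" for i using le[of "\<eta>m $ i"] \<eta>(1)[of i] by simp
  then have ends1: "u (-1) < M" unfolding bc by (intro A_plus_sum_less A M)
  have "u (\<eta>p $ i) \<le> M" for i using le[of "\<eta>p $ i"] \<eta>(2)[of i] by simp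
  then have ends2: "u 1 < M" unfolding bc by (intro A_plus_sum_less A M)
  define Z where "Z = {t \<in> {-1..1}. u t = M}"
  have "closed Z" unfolding Z_def by (intro continuous_closed_preimage_constant cont) simp
  moreover have bdd: "bdd_above Z" and "y \<in> Z" using y by (auto simp: Z_def M_def)
  ultimately have "Sup Z \<in> Z" using closed_contains_Sup by blast
  then obtain z where z: "z = Sup Z" "z \<in> {-1..1}" "u z = M" by (auto simp: Z_def)
  have z1: "z \<in> {-1<..<1}" using z ends1 ends2 by (cases "z = 1"; cases "z = -1") auto
  have "DERIV u z :> u' z" using der z1 by blast
  moreover have "0 < min (1 - z) (z + 1)" using z1 by auto
  moreover have "\<forall>t. \<bar>z - t\<bar> < min (1 - z) (z + 1) \<longrightarrow> u t \<le> u z"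
    using le z by (auto simp: abs_less_iff)
  ultimately have "u' z = 0" by (rule DERIV_local_max)
  have "isCont u z" using der z1 by (meson DERIV_isCont)
  then have "\<forall>\<^sub>F t in at z. u t > 0"
    using z M by (metis isCont_def order_tendstoD(1))
  then obtain d where d: "d > 0" "\<And>t. t \<noteq> z \<Longrightarrow> dist t z < d \<Longrightarrow> u t > 0"
    by (auto simp: eventually_at)
  \<comment> \<open>\<open>c\<close> is so close to \<open>z\<close> that \<open>u\<close> stays
    positive on \<open>[z, c]\<close>, where convexity applies.\<close>
  define c where "c = z + min d (1 - z) / 2"
  have c: "z < c" "c < 1" "c < z + d" using d(1) z1 by (auto simp: c_def min_def field_simps)
  have pos: "u t > 0" if "z \<le> t" "t \<le> c" for t
    using d(2)[of t] that c z M by (cases "t = z") (auto simp: dist_real_def)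
  have mono: "u' t \<ge> 0" if "z \<le> t" "t \<le> c" for t
  proof -
    have "u' z \<le> u' t"
    proof (rule DERIV_nonneg_imp_nondecreasing[of z t u'])
      fix s assume "z \<le> s" "s \<le> t"
      then show "\<exists>y. (u' has_real_derivative y) (at s) \<and> y \<ge> 0"
        using that z1 c convex[of s] pos[of s] der(2)[of s] by (intro exI[of _ "u'' s"]) auto
    qed (use that in simp)
    then show ?thesis using \<open>u' z = 0\<close> by simp
  qed
  have "u z \<le> u c"
  proof (rule DERIV_nonneg_imp_nondecreasing[of z c u])
    fix s assume "z \<le> s" "s \<le> c"
    then show "\<exists>y. (u has_real_derivative y) (at s) \<and> y \<ge> 0"
      using z1 c mono[of s] der(1)[of s] by (intro exI[of _ "u' s"]) auto
  qed (use c in simp)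
  then have "c \<in> Z" using le[of c] z z1 c by (auto simp: Z_def)
  then show False using cSup_upper[OF _ bdd] z(1) c(1) by fastforce
qed

text \<open>After multiplication by \<open>\<nu>\<close> the function starts increasing and has a
  single critical point inside. A minimum there would require it to increase all the way from -1 up
  to its minimum. So minima sit only at the end points, where the boundary conditions rule out a
  negative value.\<close>

lemma T_set_1_positive:
  fixes \<alpha>m \<eta>m :: "real ^ 'm" and \<alpha>p \<eta>p :: "real ^ 'p"
  assumes A: "\<alpha>m \<in> A_plus" "\<alpha>p \<in> A_plus"
    and \<eta>: "\<And>i. \<eta>m $ i \<in> {-1<..<1}" "\<And>i. \<eta>p $ i \<in> {-1<..<1}"
    and u: "u \<in> T_set \<alpha>m \<eta>m \<alpha>p \<eta>p 1 \<nu>" and x: "x \<in> {-1<..<1}"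
  shows "\<nu> * u x > 0"
proof -
  define f where "f t = \<nu> * u t" for t
  define f' where "f' t = \<nu> * dI u t" for t
  have C2: "u \<in> C2_I" and bc: "f (-1) = (\<Sum>i\<in>UNIV. \<alpha>m $ i * f (\<eta>m $ i))" "f 1 = (\<Sum>i\<in>UNIV. \<alpha>p $ i * f (\<eta>p $ i))"
    and init: "f' (-1) > 0" and card: "card (interior_zeros (dI u)) = 1"
    using u by (auto simp: T_set_def X_space_def f_def f'_def sum_distrib_left mult_ac)
  have \<nu>: "\<nu> \<noteq> 0" using init by (auto simp: f'_def)
  note C2 = C2_I_facts[OF C2]
  have cont: "continuous_on {-1..1} f" "continuous_on {-1..1} f'"
    unfolding f_def f'_def by (intro continuous_intros C2)+
  have der: "(f has_real_derivative f' t) (at t)" if "t \<in> {-1<..<1}" for t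
    unfolding f_def f'_def by (intro DERIV_cmult C2(3) that)
  have not_min: "\<exists>t\<in>{-1..1}. f t < f y" if y: "y \<in> {-1<..<1}" for y
  proof (rule ccontr)
    assume "\<not> ?thesis"
    then have min: "f y \<le> f t" if "t \<in> {-1..1}" for t using that by force
    have "DERIV f y :> f' y" using der y by blast
    moreover have "0 < min (1 - y) (y + 1)" using y by auto
    moreover have "\<forall>t. \<bar>y - t\<bar> < min (1 - y) (y + 1) \<longrightarrow> f y \<le> f t"
      using min by (auto simp: abs_less_iff)
    ultimately have "f' y = 0" by (rule DERIV_local_min)
    then have "y \<in> interior_zeros (dI u)" using y \<nu> by (auto simp: interior_zeros_def f'_def)
    then have only: "interior_zeros (dI u) = {y}" using card by (auto simp: card_1_singleton_iff)
    \<comment> \<open>Otherwise the intermediate value theorem, starting from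
      \<open>f' (-1) > 0\<close>, gives a second critical point before \<open>y\<close>.\<close>
    have "f' t > 0" if t: "-1 < t" "t < y" for t
    proof (rule ccontr)
      assume "\<not> f' t > 0"
      then have "\<exists>c\<ge>-1. c \<le> t \<and> f' c = 0"
        using t y init by (intro IVT2' continuous_on_subset[OF cont(2)]) auto
      then obtain c where c: "-1 \<le> c" "c \<le> t" "f' c = 0" by auto
      then have "c \<noteq> -1" using init by auto
      then have "c \<in> interior_zeros (dI u)" using c t y \<nu> by (auto simp: interior_zeros_def f'_def)
      then show False using only c t by auto
    qed
    note f'_pos = this
    have "f (-1) < f y"
    proof (rule DERIV_pos_imp_increasing_open[of "-1" y f])
      fix t assume t: "-1 < t" "t < y"
      then show "\<exists>z. (f has_real_derivative z) (at t) \<and> z > 0"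
        using f'_pos[OF t] der[of t] y by (intro exI[of _ "f' t"]) auto
    next
      show "continuous_on {-1..y} f" using y by (intro continuous_on_subset[OF cont(1)]) auto
    qed (use y in auto)
    then show False using min[of "-1"] by simp
  qed
  obtain y where y: "y \<in> {-1..1}" "\<And>t. t \<in> {-1..1} \<Longrightarrow> f y \<le> f t"
    using continuous_attains_inf[of "{-1..1}" f] cont by fastforce
  have ge: "- f t \<le> - f y" if "t \<in> {-1<..<1}" for t using y(2)[of t] that by auto
  have "f y \<ge> 0"
  proof (rule ccontr)
    assume "\<not> f y \<ge> 0"
    then have neg: "0 < - f y" by simp
    \<comment> \<open>Applied to \<open>- f\<close>, the weight bound puts both end values strictly
      above a negative minimum, which would then be interior.\<close>
    have "(\<Sum>i\<in>UNIV. \<alpha>m $ i * - f (\<eta>m $ i)) < - f y"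
      by (rule A_plus_sum_less[OF A(1) neg], rule ge, rule \<eta>)
    moreover have "(\<Sum>i\<in>UNIV. \<alpha>p $ i * - f (\<eta>p $ i)) < - f y"
      by (rule A_plus_sum_less[OF A(2) neg], rule ge, rule \<eta>)
    ultimately have "f y < f (-1)" "f y < f 1" by (simp_all add: bc sum_negf)
    then have "y \<in> {-1<..<1}" using y(1) by (cases "y = 1"; cases "y = -1") auto
    then show False using not_min y(2) by force
  qed
  then show ?thesis using not_min[OF x] y(2) x by (force simp: f_def)
qed

section \<open>The asymmetric oscillator\<close>

lemma mult_divide_sqrt: "r > 0 \<Longrightarrow> r * c / sqrt r = sqrt r * c"
  by (simp add: field_simps)

lemma DERIV_cos_scaled: "r \<noteq> 0 \<Longrightarrow> ((\<lambda>t. cos (r * (t - c)) / r) has_real_derivative - sin (r * (t - c))) (at t)"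
  by (auto intro!: derivative_eq_intros)

locale asymmetric_oscillator =
  fixes a b :: real
  assumes a_pos: "a > 0" and b_pos: "b > 0"
begin

text \<open>Quarter periods of \<open>y'' = - a y\<close> and \<open>y'' = - b y\<close>; one arch
  takes two of them, so the oscillator has period \<open>2 * h\<close>.\<close>

definition wa where "wa = pi / (2 * sqrt a)"
definition wb where "wb = pi / (2 * sqrt b)"
definition h where "h = wa + wb"

definition restoring_force :: "real \<Rightarrow> real" where
  "restoring_force y = a * max y 0 - b * max (- y) 0"

text \<open>An antiderivative of \<open>2 * restoring_force\<close>, hence the potential part of the
  conserved energy.\<close>

definition potential :: "real \<Rightarrow> real" where
  "potential y = a * (max y 0)\<^sup>2 + b * (max (- y) 0)\<^sup>2"

text \<open>
  On the period \<open>[-wa, wa + 2 wb]\<close> the oscillator consists of a positive arch of half-width \<open>wa\<close>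
  centred at \<open>0\<close> and a negative arch of half-width \<open>wb\<close> centred at \<open>h\<close>, so that its critical points
  are exactly the multiples of \<open>h\<close>.
\<close>

definition branch :: "real \<Rightarrow> real" where
  "branch t = (if t \<le> wa then cos (sqrt a * t) / sqrt a else - cos (sqrt b * (t - h)) / sqrt b)"

definition branch' :: "real \<Rightarrow> real" where
  "branch' t = (if t \<le> wa then - sin (sqrt a * t) else sin (sqrt b * (t - h)))"

text \<open>Representative of \<open>t\<close> modulo \<open>2 * h\<close>; adding \<open>wa\<close>
  before rounding makes the period start at \<open>- wa\<close>, the left end of the positive
  arch.\<close>

definition phase :: "real \<Rightarrow> real" where
  "phase t = t - 2 * h * \<lfloor>(t + wa) / (2 * h)\<rfloor>"

definition osc :: "real \<Rightarrow> real" where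
  "osc t = branch (phase t)"

definition osc' :: "real \<Rightarrow> real" where
  "osc' t = branch' (phase t)"

lemma wa_pos: "wa > 0" and wb_pos: "wb > 0" and h_pos: "h > 0"
  using a_pos b_pos by (auto simp: wa_def wb_def h_def intro: add_pos_pos)

lemma sqrt_wa: "sqrt a * wa = pi / 2" and sqrt_wb: "sqrt b * wb = pi / 2"
  using a_pos b_pos by (auto simp: wa_def wb_def)

lemma wa_minus_h: "wa - h = - wb" by (simp add: h_def)

text \<open>The arches meet at \<open>wa\<close>, both with value 0 and slope -1.\<close>

lemma branch_DERIV: "(branch has_real_derivative branch' t) (at t)"
  unfolding branch_def[abs_def] branch'_def
proof (rule DERIV_If_le)
  show "((\<lambda>t. cos (sqrt a * t) / sqrt a) has_real_derivative - sin (sqrt a * t)) (at t)" for t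
    using DERIV_cos_scaled[of "sqrt a" 0] a_pos by simp
  show "((\<lambda>t. - cos (sqrt b * (t - h)) / sqrt b) has_real_derivative sin (sqrt b * (t - h))) (at t)" for t
    using DERIV_minus[OF DERIV_cos_scaled[of "sqrt b" h]] b_pos by simp
  show "cos (sqrt a * wa) / sqrt a = - cos (sqrt b * (wa - h)) / sqrt b"
    by (simp add: wa_minus_h sqrt_wa sqrt_wb)
  show "- sin (sqrt a * wa) = sin (sqrt b * (wa - h))"
    by (simp add: wa_minus_h sqrt_wa sqrt_wb)
qed

lemma branch_nonneg: "branch t \<ge> 0" if "t \<in> {-wa..wa}"
proof -
  have "\<bar>sqrt a * t\<bar> \<le> sqrt a * wa"
    using that a_pos by (auto simp: abs_mult intro!: mult_left_mono)
  then have "cos (sqrt a * t) \<ge> 0"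
    by (intro cos_ge_zero) (auto simp: sqrt_wa)
  then show ?thesis using that a_pos by (simp add: branch_def)
qed

lemma branch_nonpos: "branch t \<le> 0" if "t \<in> {wa<..wa + 2 * wb}"
proof -
  have "\<bar>sqrt b * (t - h)\<bar> \<le> sqrt b * wb"
    using that b_pos by (auto simp: abs_mult h_def intro!: mult_left_mono)
  then have "cos (sqrt b * (t - h)) \<ge> 0"
    by (intro cos_ge_zero) (auto simp: sqrt_wb)
  then show ?thesis using that b_pos by (simp add: branch_def)
qed

text \<open>The range is one period, because there the sign of \<open>branch\<close>, which selects
  \<open>a\<close> or \<open>b\<close> in the force, matches the arch selected by
  \<open>t \<le> wa\<close>.\<close>

lemma branch'_DERIV: 
  assumes t: "t \<in> {-wa..wa + 2 * wb}"
  shows "(branch' has_real_derivative - restoring_force (branch t)) (at t)"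
proof -
  have "(branch' has_real_derivative
     (if t \<le> wa then - sqrt a * cos (sqrt a * t) else sqrt b * cos (sqrt b * (t - h)))) (at t)"
    unfolding branch'_def[abs_def]
  proof (rule DERIV_If_le)
    show "((\<lambda>t. - sin (sqrt a * t)) has_real_derivative - sqrt a * cos (sqrt a * t)) (at t)" for t
      by (auto intro!: derivative_eq_intros)
    show "((\<lambda>t. sin (sqrt b * (t - h))) has_real_derivative sqrt b * cos (sqrt b * (t - h))) (at t)" for t
      by (auto intro!: derivative_eq_intros)
  qed (simp_all add: wa_minus_h sqrt_wa sqrt_wb)
  moreover have "(if t \<le> wa then - sqrt a * cos (sqrt a * t) else sqrt b * cos (sqrt b * (t - h)))
    = - restoring_force (branch t)"
  proof (cases "t \<le> wa")
    case True
    then have "restoring_force (branch t) = a * branch t"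
      using branch_nonneg[of t] t by (simp add: restoring_force_def)
    then show ?thesis using True a_pos by (simp add: branch_def mult_divide_sqrt)
  next
    case False
    then have "restoring_force (branch t) = b * branch t"
      using branch_nonpos[of t] t by (simp add: restoring_force_def)
    then show ?thesis using False b_pos by (simp add: branch_def mult_divide_sqrt)
  qed
  ultimately show ?thesis by simp
qed

lemma branch_energy: 
  assumes t: "t \<in> {-wa..wa + 2 * wb}"
  shows "(branch' t)\<^sup>2 + potential (branch t) = 1"
proof (cases "t \<le> wa")
  case True
  then have "potential (branch t) = a * (branch t)\<^sup>2"
    using branch_nonneg[of t] t by (simp add: potential_def)
  then show ?thesis using True a_pos by (simp add: branch_def branch'_def power_divide)
next
  case False
  then have "potential (branch t) = b * (branch t)\<^sup>2"
    using branch_nonpos[of t] t by (simp add: potential_def)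
  then show ?thesis using False b_pos by (simp add: branch_def branch'_def power_divide)
qed

section \<open>Periodic extension of the oscillator\<close>

lemma branch_ends: "branch (wa + 2 * wb) = branch (- wa)" "branch' (wa + 2 * wb) = branch' (- wa)"
  using wa_pos wb_pos by (auto simp: branch_def branch'_def h_def sqrt_wa sqrt_wb)

text \<open>The closed right end is included: there \<open>phase\<close> has already wrapped to
  \<open>- wa\<close>, and by \<open>branch_ends\<close> the values agree.\<close>

lemma osc_chart:
  fixes n :: int
  assumes "t - 2 * h * n \<in> {-wa..wa + 2 * wb}"
  shows "osc t = branch (t - 2 * h * n)" "osc' t = branch' (t - 2 * h * n)"
proof -
  have *: "osc t = branch (t - 2 * h * n) \<and> osc' t = branch' (t - 2 * h * n)"
  proof (cases "t - 2 * h * n = wa + 2 * wb")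
    case True
    then have "(t + wa) / (2 * h) = n + 1"
      using h_pos by (simp add: h_def field_simps)
    then have "\<lfloor>(t + wa) / (2 * h)\<rfloor> = n + 1" by simp
    then have "phase t = - wa"
      using True by (simp add: phase_def algebra_simps h_def)
    then show ?thesis using True by (simp add: osc_def osc'_def branch_ends)
  next
    case False
    then have "real_of_int n \<le> (t + wa) / (2 * h)" "(t + wa) / (2 * h) < real_of_int n + 1"
      using h_pos assms by (auto simp: h_def field_simps)
    then have "\<lfloor>(t + wa) / (2 * h)\<rfloor> = n" by linarith
    then have "phase t = t - 2 * h * n"
      by (simp add: phase_def)
    then show ?thesis by (simp add: osc_def osc'_def)
  qed
  show "osc t = branch (t - 2 * h * n)" "osc' t = branch' (t - 2 * h * n)" using * by auto
qed

lemma phase_range: "phase t \<in> {-wa..<wa + 2 * wb}"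
proof -
  define n where "n = \<lfloor>(t + wa) / (2 * h)\<rfloor>"
  have "real_of_int n \<le> (t + wa) / (2 * h)" "(t + wa) / (2 * h) < real_of_int n + 1"
    by (auto simp: n_def)
  then have "n * (2 * h) \<le> t + wa" "t + wa < (real_of_int n + 1) * (2 * h)"
    using h_pos by (simp_all add: pos_le_divide_eq pos_divide_less_eq)
  moreover have "phase t = t - 2 * h * n" by (simp add: phase_def n_def)
  moreover have "wa + 2 * wb = 2 * h - wa" by (simp add: h_def)
  ultimately show ?thesis by (simp add: algebra_simps)
qed

lemma chart_cases:
  obtains n :: int where "t - 2 * h * n \<in> {-wa..<wa + 2 * wb}"
  using phase_range[of t] unfolding phase_def by blast

lemma osc_energy: "(osc' t)\<^sup>2 + potential (osc t) = 1"
  using branch_energy[of "phase t"] phase_range[of t] by (auto simp: osc_def osc'_def)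

lemma osc_periodic: "osc (t + 2 * h * of_int n) = osc t" "osc' (t + 2 * h * of_int n) = osc' t"
proof -
  have "(t + 2 * h * of_int n + wa) / (2 * h) = (t + wa) / (2 * h) + of_int n"
    using h_pos by (simp add: field_simps)
  then have "phase (t + 2 * h * of_int n) = phase t"
    by (simp add: phase_def algebra_simps)
  then show "osc (t + 2 * h * of_int n) = osc t" "osc' (t + 2 * h * of_int n) = osc' t"
    by (auto simp: osc_def osc'_def)
qed

lemma osc_minus: "osc (- t) = osc t" "osc' (- t) = - osc' t"
proof -
  obtain n :: int where n: "t - 2 * h * n \<in> {-wa..<wa + 2 * wb}" by (rule chart_cases)
  define s where "s = t - 2 * h * n"
  have t: "osc t = branch s" "osc' t = branch' s"
    using osc_chart[of t n] n by (auto simp: s_def)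
  have "osc (- t) = branch s \<and> osc' (- t) = - branch' s"
  proof (cases "s \<le> wa")
    case True
    then have "- t - 2 * h * of_int (- n) = - s" "- s \<in> {- wa..wa}" "-s \<in> {-wa..wa+2 * wb}"
      using n wb_pos by (auto simp: s_def)
    then show ?thesis using osc_chart[of "- t" "- n"] True by (simp add: branch_def branch'_def)
  next
    case False
    then have s: "wa < s" "s < wa + 2 * wb" using n by (auto simp: s_def)
    \<comment> \<open>Reflection sends the negative arch of period \<open>n\<close> to that of
      period \<open>- n - 1\<close>, where the position \<open>s\<close> becomes
      \<open>2 * h - s\<close>.\<close>
    have 1: "- t - 2 * h * of_int (- n - 1) = 2 * h - s" "2 * h - s \<in> {-wa..wa+2 * wb}" "wa \<le> 2 * h - s"
      using s wa_pos by (auto simp: h_def) (auto simp: s_def h_def algebra_simps)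
    have 2: "branch (2 * h - s) = - cos (sqrt b * (h - s)) / sqrt b"
      "branch' (2 * h - s) = sin (sqrt b * (h - s))"
    proof -
      have "branch (2 * h - s) = - cos (sqrt b * (h - s)) / sqrt b \<and> branch' (2 * h - s) = sin (sqrt b * (h - s))"
      proof (cases "2 * h - s = wa")
        case True
        then have "h - s = - wb" by (simp add: h_def)
        then show ?thesis using True by (simp add: branch_def branch'_def sqrt_wa sqrt_wb)
      next
        case False
        then show ?thesis using 1 by (auto simp: branch_def branch'_def)
      qed
      then show "branch (2 * h - s) = - cos (sqrt b * (h - s)) / sqrt b"
      "branch' (2 * h - s) = sin (sqrt b * (h - s))" by auto
    qed
    have 3: "cos (sqrt b * (h - s)) = cos (sqrt b * (s - h))" "sin (sqrt b * (h - s)) = - sin (sqrt b * (s - h))"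
      by (metis cos_minus minus_diff_eq mult_minus_right, metis sin_minus minus_diff_eq mult_minus_right)
    have "osc (- t) = branch (2 * h - s)" "osc' (- t) = branch' (2 * h - s)"
      using osc_chart[of "- t" "- n - 1"] 1(2) unfolding 1(1) by auto
    then show ?thesis using False unfolding 2 3 by (simp add: branch_def branch'_def)
  qed
  then show "osc (- t) = osc t" "osc' (- t) = - osc' t" using t by auto
qed

lemma osc_DERIV_aux:
  assumes "t - 2 * h * of_int n \<in> {-wa<..<wa + 2 * wb}"
  shows "(osc has_real_derivative osc' t) (at t) \<and>
    (osc' has_real_derivative - restoring_force (osc t)) (at t)"
proof -
  define S where "S = {2 * h * of_int n - wa <..< 2 * h * of_int n + wa + 2 * wb}"
  have S: "open S" "t \<in> S" using assms by (auto simp: S_def)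
  have eq: "osc x = branch (x - 2 * h * n)" "osc' x = branch' (x - 2 * h * n)" if "x \<in> S" for x
    using osc_chart[of x n] that by (auto simp: S_def)
  have "((\<lambda>x. branch (x - 2 * h * n)) has_real_derivative branch' (t - 2 * h * n)) (at t)"
    using DERIV_shift[of branch _ t "- 2 * h * n"] branch_DERIV[of "t - 2 * h * n"] by simp
  then have 1: "(osc has_real_derivative osc' t) (at t)"
    using has_field_derivative_transform_within_open[OF _ S, of _ _ osc] eq S by auto
  have "((\<lambda>x. branch' (x - 2 * h * n)) has_real_derivative - restoring_force (branch (t - 2 * h * n))) (at t)"
    using DERIV_shift[of branch' _ t "- 2 * h * n"] branch'_DERIV[of "t - 2 * h * n"] assms by simp
  then have "(osc' has_real_derivative - restoring_force (osc t)) (at t)"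
    using has_field_derivative_transform_within_open[OF _ S, of _ _ osc'] eq S by auto
  with 1 show ?thesis by simp
qed

text \<open>The open charts miss only the seam \<open>- wa\<close> modulo the period. Reflection
  carries it to \<open>wa\<close>, an interior point of a chart, and the derivatives are pulled back
  from there.\<close>

lemma osc_DERIV: "(osc has_real_derivative osc' t) (at t)" (is ?A)
  and osc'_DERIV: "(osc' has_real_derivative - restoring_force (osc t)) (at t)" (is ?B)
proof -
  have "?A \<and> ?B"
  proof -
    obtain n :: int where n: "t - 2 * h * n \<in> {-wa..<wa + 2 * wb}" by (rule chart_cases)
    show ?thesis
    proof (cases "t - 2 * h * n = - wa")
      case True
      then have "- t - 2 * h * of_int (- n) \<in> {-wa<..<wa + 2 * wb}"
        using wa_pos wb_pos by auto
      from osc_DERIV_aux[OF this]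
      have 1: "(osc has_real_derivative - osc' t) (at (- t))"
        and 2: "(osc' has_real_derivative - restoring_force (osc t)) (at (- t))"
        by (simp_all add: osc_minus)
      have "((\<lambda>x. osc (- x)) has_real_derivative osc' t) (at t)"
        using 1 by (simp add: DERIV_mirror)
      moreover have "((\<lambda>x. - osc' (- x)) has_real_derivative - restoring_force (osc t)) (at t)"
        using 2 unfolding DERIV_mirror by (rule DERIV_minus[THEN DERIV_cong]) simp
      ultimately show ?thesis by (simp add: osc_minus)
    next
      case False
      then show ?thesis using n by (intro osc_DERIV_aux[of _ n]) auto
    qed
  qed
  then show ?A ?B by auto
qed

section \<open>Critical points and monotonicity of the oscillator\<close>

lemma osc_0: "osc 0 = 1 / sqrt a" "osc' 0 = 0"
  using osc_chart[of 0 0] wa_pos wb_pos by (auto simp: branch_def branch'_def)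

lemma osc_h: "osc h = - 1 / sqrt b" "osc' h = 0"
  using osc_chart[of h 0] wa_pos wb_pos by (auto simp: branch_def branch'_def h_def)

lemma osc'_neg:
  assumes "t \<in> {0<..<h}"
  shows "osc' t < 0"
proof (cases "t \<le> wa")
  case True
  then have "osc' t = - sin (sqrt a * t)"
    using osc_chart[of t 0] assms wb_pos by (auto simp: branch'_def h_def)
  moreover have "sqrt a * t \<le> sqrt a * wa" "0 < sqrt a * t"
    using True a_pos assms by (auto intro!: mult_left_mono)
  then have "sin (sqrt a * t) > 0"
    unfolding sqrt_wa using pi_gt_zero by (intro sin_gt_zero) linarith+
  ultimately show ?thesis by simp
next
  case False
  then have "osc' t = - sin (sqrt b * (h - t))"
    using osc_chart[of t 0] assms wb_pos wa_pos 
    by (auto simp: branch'_def h_def) (metis h_def minus_diff_eq mult_minus_right sin_minus)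
  moreover have "sqrt b * (h - t) \<le> sqrt b * wb" "0 < sqrt b * (h - t)"
    using False b_pos assms by (auto simp: h_def intro!: mult_left_mono)
  then have "sin (sqrt b * (h - t)) > 0"
    unfolding sqrt_wb using pi_gt_zero by (intro sin_gt_zero) linarith+
  ultimately show ?thesis by simp
qed

subsection \<open>Boundary conditions in terms of phases\<close>

text \<open>The sign \<open>(-1)^n\<close> for integer \<open>n\<close>, which is the sign of
  \<open>osc\<close> at the critical point \<open>n * h\<close>.\<close>

definition parity :: "int \<Rightarrow> real" where
  "parity n = (if even n then 1 else -1)"

definition cell :: "int \<Rightarrow> real set" where
  "cell n = {n * h<..<(n + 1) * h}"

lemma osc'_sign:
  assumes "t \<in> cell n"
  shows "parity n * osc' t < 0"
proof (cases "even n")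
  case True
  then obtain m where m: "n = 2 * m" by auto
  have "osc' (t - 2 * h * m) < 0"
    using assms by (intro osc'_neg) (auto simp: m cell_def algebra_simps)
  then show ?thesis using True osc_periodic(2)[of "t - 2 * h * m" m] by (simp add: parity_def)
next
  case False
  then obtain m where m: "n = 2 * m + 1" by (auto elim: oddE)
  \<comment> \<open>Shifted back by \<open>m + 1\<close> periods, \<open>t\<close> falls into
    \<open>(-h, 0)\<close>; oddness of \<open>osc'\<close> then leads to
    \<open>(0, h)\<close>.\<close>
  have "osc' (- (t - 2 * h * of_int (m + 1))) < 0"
    using assms by (intro osc'_neg) (auto simp: m cell_def algebra_simps)
  then show ?thesis using False osc_periodic(2)[of "t - 2 * h * of_int (m + 1)" "m + 1"]
    unfolding osc_minus(2) by (simp add: parity_def)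
qed

lemma osc_node: "osc (of_int n * h) = (if even n then 1 / sqrt a else - 1 / sqrt b)"
  and osc'_node: "osc' (of_int n * h) = 0"
proof -
  have "osc (of_int n * h) = (if even n then 1 / sqrt a else - 1 / sqrt b) \<and> osc' (of_int n * h) = 0"
  proof (cases "even n")
    case True
    then obtain m where m: "n = 2 * m" by auto
    show ?thesis using osc_periodic[of 0 m] osc_0 by (simp add: m mult_ac)
  next
    case False
    then obtain m where m: "n = 2 * m + 1" by (auto elim: oddE)
    have "of_int n * h = h + 2 * h * m" by (simp add: m algebra_simps)
    then show ?thesis using osc_periodic[of h m] osc_h False by simp
  qed
  then show "osc (of_int n * h) = (if even n then 1 / sqrt a else - 1 / sqrt b)"
    "osc' (of_int n * h) = 0" by auto
qed

lemma node_or_cell: "t = of_int \<lfloor>t / h\<rfloor> * h \<or> t \<in> cell \<lfloor>t / h\<rfloor>"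
proof -
  have "of_int \<lfloor>t / h\<rfloor> * h \<le> t"
    using h_pos by (simp flip: pos_le_divide_eq)
  moreover have "t < of_int (\<lfloor>t / h\<rfloor> + 1) * h"
    using h_pos by (subst pos_divide_less_eq[symmetric]) auto
  ultimately show ?thesis by (auto simp: cell_def)
qed

lemma osc'_eq_0_iff: "osc' t = 0 \<longleftrightarrow> (\<exists>n. t = of_int n * h)"
  using osc'_node osc'_sign node_or_cell[of t] by fastforce

lemma osc_ne_0: "osc' t = 0 \<Longrightarrow> osc t \<noteq> 0"
  using osc_energy[of t] by (auto simp: potential_def)

lemma cell_unique: "t \<in> cell n \<Longrightarrow> t \<in> cell m \<Longrightarrow> n = m"
proof -
  have "n \<le> m" if "t \<in> cell n" "t \<in> cell m" for n m
  proof -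
    have "of_int n * h < of_int (m + 1) * h" using that by (auto simp: cell_def)
    then have "n < m + 1" using h_pos by (simp add: mult_less_cancel_right del: of_int_add)
    then show ?thesis by simp
  qed
  then show "t \<in> cell n \<Longrightarrow> t \<in> cell m \<Longrightarrow> n = m" by (meson order_antisym)
qed

lemma cell_less: "x \<in> cell n \<Longrightarrow> y \<in> cell m \<Longrightarrow> n < m \<Longrightarrow> x < y"
proof -
  assume xy: "x \<in> cell n" "y \<in> cell m" "n < m"
  have "of_int (n + 1) * h \<le> of_int m * h" using xy h_pos by (intro mult_right_mono) auto
  then show "x < y" using xy by (auto simp: cell_def)
qed

lemma cell_shift: "x + h * of_int j \<in> cell (n + j) \<longleftrightarrow> x \<in> cell n"
  by (auto simp: cell_def algebra_simps)

lemma osc_bounds: "sqrt a * osc t \<le> 1" "- sqrt b * osc t \<le> 1"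
proof -
  have p: "potential (osc t) \<le> 1"
    using osc_energy[of t] zero_le_power2[of "osc' t"] by linarith
  show "sqrt a * osc t \<le> 1"
  proof (cases "osc t \<ge> 0")
    case True
    then have "(sqrt a * osc t)\<^sup>2 \<le> 1\<^sup>2" using p a_pos by (simp add: potential_def power_mult_distrib)
    then show ?thesis by (rule power2_le_imp_le) simp
  next
    case False
    then have "sqrt a * osc t \<le> 0" using a_pos by (simp add: mult_le_0_iff)
    then show ?thesis by linarith
  qed
  show "- sqrt b * osc t \<le> 1"
  proof (cases "osc t \<le> 0")
    case True
    then have "(- sqrt b * osc t)\<^sup>2 \<le> 1\<^sup>2" using p b_pos by (simp add: potential_def power_mult_distrib)
    then show ?thesis by (rule power2_le_imp_le) simp
  next
    case False
    then have "- sqrt b * osc t \<le> 0" using b_pos by (simp add: mult_le_0_iff)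
    then show ?thesis by linarith
  qed
qed

text \<open>Common form of the data at both ends: \<open>w\<close> holds the weights and
  \<open>r\<close> the relative distances of the inner points from the end concerned.\<close>

definition admissible :: "('i::finite \<Rightarrow> real) \<Rightarrow> ('i \<Rightarrow> real) \<Rightarrow> bool" where
  "admissible w r \<longleftrightarrow> (\<forall>i. 0 \<le> w i \<and> 0 \<le> r i \<and> r i \<le> 1) \<and> sum w UNIV < 1"

text \<open>
  If \<open>u\<close> has phases \<open>p\<close> at \<open>-1\<close> and \<open>q\<close> at \<open>1\<close>, the condition at \<open>-1\<close> is \<open>bc w r p q = 0\<close> with
  \<open>r i = (1 + \<eta> i) / 2\<close>, and the condition at \<open>1\<close> is \<open>bc w r q p = 0\<close> with \<open>r i = (1 - \<eta> i) / 2\<close>.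
\<close>

definition bc :: "('i::finite \<Rightarrow> real) \<Rightarrow> ('i \<Rightarrow> real) \<Rightarrow> real \<Rightarrow> real \<Rightarrow> real" where
  "bc w r x y = osc x - (\<Sum>i\<in>UNIV. w i * osc (x + r i * (y - x)))"

text \<open>
  By the energy identity \<open>(\<surd>a osc\<^sup>+, \<bar>osc'\<bar>)\<close> lies in the unit disc, and on the unit circle where
  \<open>osc \<ge> 0\<close>. A non-negative combination of total weight \<open>< 1\<close> cannot dominate a unit vector in both
  components.
\<close>

lemma bc_deriv_dominates:
  assumes adm: "admissible w r" and bc: "bc w r x y = 0"
  shows "(\<Sum>i\<in>UNIV. w i * \<bar>osc' (x + r i * (y - x))\<bar>) < \<bar>osc' x\<bar>"
proof (rule ccontr)
  define t where "t i = x + r i * (y - x)" for i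
  assume "\<not> ?thesis"
  then have le: "\<bar>osc' x\<bar> \<le> (\<Sum>i\<in>UNIV. w i * \<bar>osc' (t i)\<bar>)" by (simp add: t_def)
  have osc_x: "osc x = (\<Sum>i\<in>UNIV. w i * osc (t i))" using bc by (simp add: bc_def t_def)
  \<comment> \<open>If the weighted sum of disc vectors dominated the unit vector
    \<open>(X, |osc' x|)\<close> in both components, the inner product with that vector would give
    \<open>1 \<le> sum w UNIV\<close>.\<close>
  have *: False if "0 \<le> X" "X\<^sup>2 + \<bar>osc' x\<bar>\<^sup>2 = 1" "X \<le> (\<Sum>i\<in>UNIV. w i * Y i)"
      "\<And>i. (Y i)\<^sup>2 + \<bar>osc' (t i)\<bar>\<^sup>2 \<le> 1" for X Y
  proof -
    have "1 = X * X + \<bar>osc' x\<bar> * \<bar>osc' x\<bar>" using that(2) by (simp add: power2_eq_square)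
    also have "\<dots> \<le> X * (\<Sum>i\<in>UNIV. w i * Y i) + \<bar>osc' x\<bar> * (\<Sum>i\<in>UNIV. w i * \<bar>osc' (t i)\<bar>)"
      using that(1,3) le by (intro add_mono mult_left_mono) auto
    also have "\<dots> \<le> sum w UNIV"
      using adm that(2,4) by (intro convex_sum_unit_le) (auto simp: admissible_def)
    also have "\<dots> < 1" using adm by (simp add: admissible_def)
    finally show False by simp
  qed
  have w: "w i \<ge> 0" for i using adm by (simp add: admissible_def)
  show False
  proof (cases "osc x \<ge> 0")
    case True
    show False
    proof (rule *[of "sqrt a * osc x" "\<lambda>i. sqrt a * max (osc (t i)) 0"])
      show "0 \<le> sqrt a * osc x" using True a_pos by simp
      show "(sqrt a * osc x)\<^sup>2 + \<bar>osc' x\<bar>\<^sup>2 = 1"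
        using osc_energy[of x] True a_pos by (simp add: potential_def power_mult_distrib)
      have "sqrt a * osc x = (\<Sum>i\<in>UNIV. w i * (sqrt a * osc (t i)))"
        by (simp add: osc_x sum_distrib_left mult_ac)
      \<comment> \<open>Replacing negative values by 0 can only raise the sum, and keeping just the
        \<open>a\<close> part of the potential turns the energy identity into a unit disc
        bound.\<close>
      also have "\<dots> \<le> (\<Sum>i\<in>UNIV. w i * (sqrt a * max (osc (t i)) 0))"
        using w a_pos by (intro sum_mono mult_left_mono) auto
      finally show "sqrt a * osc x \<le> \<dots>" .
      show "(sqrt a * max (osc (t i)) 0)\<^sup>2 + \<bar>osc' (t i)\<bar>\<^sup>2 \<le> 1" for i
        using osc_energy[of "t i"] a_pos b_pos by (simp add: potential_def power_mult_distrib)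
           (smt (verit) mult_nonneg_nonneg zero_le_power2)
    qed
  next
    case False
    show False
    proof (rule *[of "sqrt b * - osc x" "\<lambda>i. sqrt b * max (- osc (t i)) 0"])
      show "0 \<le> sqrt b * - osc x" using False b_pos by (simp add: mult_le_0_iff)
      show "(sqrt b * - osc x)\<^sup>2 + \<bar>osc' x\<bar>\<^sup>2 = 1"
        using osc_energy[of x] False b_pos by (simp add: potential_def power_mult_distrib)
      have "sqrt b * - osc x = (\<Sum>i\<in>UNIV. w i * (sqrt b * - osc (t i)))"
        by (simp add: osc_x sum_distrib_left mult_ac sum_negf)
      also have "\<dots> \<le> (\<Sum>i\<in>UNIV. w i * (sqrt b * max (- osc (t i)) 0))"
        using w b_pos by (intro sum_mono mult_left_mono) auto
      finally show "sqrt b * - osc x \<le> \<dots>" .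
      show "(sqrt b * max (- osc (t i)) 0)\<^sup>2 + \<bar>osc' (t i)\<bar>\<^sup>2 \<le> 1" for i
        using osc_energy[of "t i"] a_pos b_pos by (simp add: potential_def power_mult_distrib)
           (smt (verit) mult_nonneg_nonneg zero_le_power2)
    qed
  qed
qed

lemma bc_osc'_ne_0: "admissible w r \<Longrightarrow> bc w r x y = 0 \<Longrightarrow> osc' x \<noteq> 0"
proof
  assume "admissible w r" "bc w r x y = 0" "osc' x = 0"
  moreover from this have "0 \<le> (\<Sum>i\<in>UNIV. w i * \<bar>osc' (x + r i * (y - x))\<bar>)"
    by (intro sum_nonneg) (auto simp: admissible_def)
  ultimately show False using bc_deriv_dominates[of w r x y] by simp
qed

text \<open>
  Otherwise \<open>bc\<close> would cross zero in the same direction at each of its zeros on the segment from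
  \<open>(x, y)\<close> to \<open>(x', y')\<close>, although it vanishes at both ends.
\<close>

lemma bc_separation_less:
  assumes adm: "admissible w r" and bc: "bc w r x y = 0" "bc w r x' y' = 0"
    and cell: "x \<in> cell n" "x' \<in> cell n" and less: "x < x'"
  shows "x' - x < \<bar>y' - y\<bar>"
proof (rule ccontr)
  assume far: "\<not> ?thesis"
  define dx dy where "dx = x' - x" and "dy = y' - y"
  have d: "dx > 0" "\<bar>dy\<bar> \<le> dx" using less far by (auto simp: dx_def dy_def)
  define X where "X \<tau> = x + \<tau> * dx" for \<tau>
  define Y where "Y \<tau> = y + \<tau> * dy" for \<tau>
  define t where "t i \<tau> = X \<tau> + r i * (Y \<tau> - X \<tau>)" for i \<tau>
  \<comment> \<open>\<open>osc'\<close> has the sign opposite to \<open>parity n\<close> on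
    \<open>cell n\<close>, so the factor \<open>- parity n\<close> makes all crossings
    upward.\<close>
  define K where "K \<tau> = - parity n * bc w r (X \<tau>) (Y \<tau>)" for \<tau>
  define K' where "K' \<tau> = - parity n * (osc' (X \<tau>) * dx
      - (\<Sum>i\<in>UNIV. w i * (osc' (t i \<tau>) * (dx + r i * (dy - dx)))))" for \<tau>
  show False
  proof (rule no_two_upcrossings[of 0 1 K K'])
    fix \<tau> :: real assume \<tau>: "\<tau> \<in> {0..1}"
    have 1: "((\<lambda>\<tau>. osc (X \<tau>)) has_real_derivative osc' (X \<tau>) * dx) (at \<tau>)"
      by (rule DERIV_chain2[OF osc_DERIV]) (auto simp: X_def intro!: derivative_eq_intros)
    have 2: "((\<lambda>\<tau>. osc (t i \<tau>)) has_real_derivative osc' (t i \<tau>) * (dx + r i * (dy - dx))) (at \<tau>)" for i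
      by (rule DERIV_chain2[OF osc_DERIV])
         (auto simp: t_def X_def Y_def algebra_simps intro!: derivative_eq_intros)
    show "(K has_real_derivative K' \<tau>) (at \<tau>)"
      unfolding K_def[abs_def] K'_def bc_def t_def[symmetric]
      by (intro DERIV_cmult DERIV_diff DERIV_sum 1 2)
    assume "K \<tau> = 0"
    then have "bc w r (X \<tau>) (Y \<tau>) = 0" by (auto simp: K_def parity_def split: if_splits)
    from bc_deriv_dominates[OF adm this]
    have dom: "(\<Sum>i\<in>UNIV. w i * \<bar>osc' (t i \<tau>)\<bar>) < \<bar>osc' (X \<tau>)\<bar>" by (simp add: t_def)
    have "X \<tau> = (1 - \<tau>) * x + \<tau> * x'" by (simp add: X_def dx_def algebra_simps)
    then have "X \<tau> \<in> cell n"
      using convexD_alt[of "cell n" x x' \<tau>] cell \<tau> by (simp add: cell_def)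
    from osc'_sign[OF this] have sgn: "- parity n * osc' (X \<tau>) = \<bar>osc' (X \<tau>)\<bar>"
      by (auto simp: parity_def split: if_splits)
    have "\<bar>parity n * (\<Sum>i\<in>UNIV. w i * (osc' (t i \<tau>) * (dx + r i * (dy - dx))))\<bar>
        = \<bar>\<Sum>i\<in>UNIV. w i * (osc' (t i \<tau>) * (dx + r i * (dy - dx)))\<bar>"
      by (simp add: abs_mult parity_def)
    also have "\<dots> \<le> (\<Sum>i\<in>UNIV. \<bar>w i * (osc' (t i \<tau>) * (dx + r i * (dy - dx)))\<bar>)"
      by (rule sum_abs)
    also have "\<dots> \<le> (\<Sum>i\<in>UNIV. (w i * \<bar>osc' (t i \<tau>)\<bar>) * dx)"
    proof (rule sum_mono)
      fix i
      have wr: "0 \<le> w i" "0 \<le> r i" "r i \<le> 1" using adm by (auto simp: admissible_def)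
      \<comment> \<open>An inner phase moves with a convex combination of the end velocities
        \<open>dx\<close> and \<open>dy\<close>; since \<open>|dy| \<le> dx\<close>, its speed is at
        most \<open>dx\<close>.\<close>
      have "\<bar>dx + r i * (dy - dx)\<bar> = \<bar>(1 - r i) * dx + r i * dy\<bar>" by (simp add: algebra_simps)
      also have "\<dots> \<le> (1 - r i) * dx + r i * \<bar>dy\<bar>"
        using wr d by (intro order_trans[OF abs_triangle_ineq]) (simp add: abs_mult)
      also have "\<dots> \<le> (1 - r i) * dx + r i * dx" using wr d by (intro add_left_mono mult_left_mono)
      finally have "\<bar>dx + r i * (dy - dx)\<bar> \<le> dx" by (simp add: algebra_simps)
      then show "\<bar>w i * (osc' (t i \<tau>) * (dx + r i * (dy - dx)))\<bar> \<le> (w i * \<bar>osc' (t i \<tau>)\<bar>) * dx"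
        using wr by (simp add: abs_mult mult.assoc mult_left_mono)
    qed
    also have "\<dots> = (\<Sum>i\<in>UNIV. w i * \<bar>osc' (t i \<tau>)\<bar>) * dx" by (simp add: sum_distrib_right)
    also have "\<dots> < \<bar>osc' (X \<tau>)\<bar> * dx" using dom d by simp
    finally have "\<bar>parity n * (\<Sum>i\<in>UNIV. w i * (osc' (t i \<tau>) * (dx + r i * (dy - dx))))\<bar> < \<bar>osc' (X \<tau>)\<bar> * dx" .
    moreover have "K' \<tau> = (- parity n * osc' (X \<tau>)) * dx
       + parity n * (\<Sum>i\<in>UNIV. w i * (osc' (t i \<tau>) * (dx + r i * (dy - dx))))"
      by (simp add: K'_def algebra_simps)
    ultimately show "0 < K' \<tau>" unfolding sgn by linarith
  qed (use bc in \<open>auto simp: K_def X_def Y_def dx_def dy_def\<close>)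
qed

lemma bc_separation:
  assumes "admissible w r" "bc w r x y = 0" "bc w r x' y' = 0" "x \<in> cell n" "x' \<in> cell n" "x \<noteq> x'"
  shows "\<bar>x - x'\<bar> < \<bar>y - y'\<bar>"
  using bc_separation_less[of w r x y x' y' n] bc_separation_less[of w r x' y' x y n] assms
  by (cases "x < x'") auto

section \<open>Zeros in cells and solvability of a single boundary condition\<close>

lemma osc_continuous: "continuous_on S osc"
  using osc_DERIV by (meson DERIV_continuous_on has_field_derivative_at_within)

text \<open>Consecutive critical values have opposite signs, and \<open>osc\<close> does not vanish
  at the critical points themselves.\<close>

lemma osc_zero_in_cell: "\<exists>z\<in>cell n. osc z = 0"
proof -
  have "continuous_on {of_int n * h..of_int (n + 1) * h} (\<lambda>x. parity n * osc x)"
    by (intro continuous_intros osc_continuous)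
  moreover have "parity n * osc (of_int n * h) > 0" "parity n * osc (of_int (n + 1) * h) < 0"
    using a_pos b_pos osc_node[of n] osc_node[of "n + 1"] by (auto simp: parity_def)
  moreover have "of_int n * h \<le> of_int (n + 1) * h" using h_pos by (intro mult_right_mono) auto
  ultimately obtain z where z: "of_int n * h \<le> z" "z \<le> of_int (n + 1) * h" "parity n * osc z = 0"
    using IVT2'[of "\<lambda>x. parity n * osc x" "of_int (n + 1) * h" 0 "of_int n * h"] by force
  then have z0: "osc z = 0" by (auto simp: parity_def split: if_splits)
  then have "z \<noteq> of_int n * h" "z \<noteq> of_int (n + 1) * h"
    using osc_ne_0 osc'_node by blast+
  then have "z \<in> cell n" using z by (auto simp: cell_def)
  then show ?thesis using z0 by blast
qed

text \<open>At a critical point \<open>osc\<close> takes an extreme value, \<open>1 / sqrt a\<close>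
  or \<open>- 1 / sqrt b\<close>, which weights of total below 1 cannot reproduce.\<close>

lemma bc_node: 
  assumes "admissible w r"
  shows "parity n * bc w r (of_int n * h) y > 0"
proof -
  have w: "w i \<ge> 0" "sum w UNIV < 1" for i using assms by (auto simp: admissible_def)
  define t where "t i = of_int n * h + r i * (y - of_int n * h)" for i
  show ?thesis
  proof (cases "even n")
    case True
    have "(\<Sum>i\<in>UNIV. w i * osc (t i)) \<le> (\<Sum>i\<in>UNIV. w i * (1 / sqrt a))"
      using w osc_bounds(1) a_pos by (intro sum_mono mult_left_mono) (auto simp: pos_le_divide_eq mult.commute)
    also have "\<dots> = sum w UNIV * (1 / sqrt a)" by (simp only: sum_distrib_right)
    also have "\<dots> < 1 * (1 / sqrt a)" using w a_pos by (intro mult_strict_right_mono) auto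
    finally show ?thesis using True by (simp add: parity_def bc_def t_def osc_node)
  next
    case False
    have "(\<Sum>i\<in>UNIV. w i * - osc (t i)) \<le> (\<Sum>i\<in>UNIV. w i * (1 / sqrt b))"
      using w osc_bounds(2) b_pos by (intro sum_mono mult_left_mono) (auto simp: pos_le_divide_eq mult.commute)
    also have "\<dots> = sum w UNIV * (1 / sqrt b)" by (simp only: sum_distrib_right)
    also have "\<dots> < 1 * (1 / sqrt b)" using w b_pos by (intro mult_strict_right_mono) auto
    finally show ?thesis using False by (simp add: parity_def bc_def t_def osc_node sum_negf)
  qed
qed

text \<open>By \<open>bc_node\<close> the sign of \<open>bc\<close> alternates between consecutive
  critical points, and these are no solutions themselves.\<close>

lemma bc_ex:
  assumes "admissible w r"
  shows "\<exists>x\<in>cell n. bc w r x y = 0"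
proof -
  have "continuous_on {of_int n * h..of_int (n + 1) * h} (\<lambda>x. parity n * bc w r x y)"
    unfolding bc_def by (intro continuous_intros continuous_on_compose2[OF osc_continuous[of UNIV]]) auto
  moreover have "parity n * bc w r (of_int n * h) y > 0" using assms by (rule bc_node)
  moreover have "parity n * bc w r (of_int (n + 1) * h) y < 0"
    using bc_node[OF assms, of "n + 1" y] by (auto simp: parity_def split: if_splits)
  moreover have "of_int n * h \<le> of_int (n + 1) * h" using h_pos by (intro mult_right_mono) auto
  ultimately obtain x where x: "of_int n * h \<le> x" "x \<le> of_int (n + 1) * h" "parity n * bc w r x y = 0"
    using IVT2'[of "\<lambda>x. parity n * bc w r x y" "of_int (n + 1) * h" 0 "of_int n * h"] by force
  then have "bc w r x y = 0" by (auto simp: parity_def split: if_splits)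
  moreover have "x \<noteq> of_int n * h" "x \<noteq> of_int (n + 1) * h"
    using bc_osc'_ne_0[OF assms \<open>bc w r x y = 0\<close>] osc'_node by blast+
  ultimately show ?thesis using x by (auto simp: cell_def)
qed

section \<open>The system of both phase equations\<close>

definition bvp where
  "bvp w r v s p q \<longleftrightarrow> bc w r p q = 0 \<and> bc v s q p = 0"

text \<open>\<open>P\<close> and \<open>Q\<close> solve one equation each. By
  \<open>bc_separation\<close> both strictly shrink distances, but with no uniform factor
  established, so the fixed point of \<open>P \<circ> Q\<close> comes from Edelstein's theorem on
  the compact closed cell.\<close>

lemma bvp_ex:
  assumes w: "admissible w r" and v: "admissible v s"
  shows "\<exists>p\<in>cell n. \<exists>q\<in>cell m. bvp w r v s p q"
proof -
  define P where "P y = (SOME x. x \<in> cell n \<and> bc w r x y = 0)" for y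
  define Q where "Q x = (SOME y. y \<in> cell m \<and> bc v s y x = 0)" for x
  have P: "P y \<in> cell n" "bc w r (P y) y = 0" for y
    using someI_ex[of "\<lambda>x. x \<in> cell n \<and> bc w r x y = 0"] bc_ex[OF w, of n y] by (auto simp: P_def)
  have Q: "Q x \<in> cell m" "bc v s (Q x) x = 0" for x
    using someI_ex[of "\<lambda>y. y \<in> cell m \<and> bc v s y x = 0"] bc_ex[OF v, of m x] by (auto simp: Q_def)
  let ?S = "{of_int n * h..of_int (n + 1) * h}"
  have sub: "cell n \<subseteq> ?S" by (auto simp: cell_def)
  have "\<exists>!x\<in>?S. (P \<circ> Q) x = x"
  proof (rule Edelstein_fix)
    show "compact ?S" by simp
    show "?S \<noteq> {}" using h_pos by (auto intro: mult_right_mono)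
    show "(P \<circ> Q) ` ?S \<subseteq> ?S" using P(1) sub by fastforce
    show "x \<noteq> y \<longrightarrow> dist ((P \<circ> Q) x) ((P \<circ> Q) y) < dist x y" for x y
    proof
      assume "x \<noteq> y"
      have "Q x = Q y \<or> \<bar>Q x - Q y\<bar> < \<bar>x - y\<bar>"
        using bc_separation[OF v] Q by metis
      moreover have "P (Q x) = P (Q y) \<or> \<bar>P (Q x) - P (Q y)\<bar> < \<bar>Q x - Q y\<bar>"
        using bc_separation[OF w] P by metis
      ultimately show "dist ((P \<circ> Q) x) ((P \<circ> Q) y) < dist x y"
        using \<open>x \<noteq> y\<close> by (auto simp: dist_real_def)
    qed
  qed
  then obtain p where p: "P (Q p) = p" by auto
  then have "bvp w r v s p (Q p)" using P(2)[of "Q p"] Q(2) by (simp add: bvp_def)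
  then show ?thesis using p P(1)[of "Q p"] Q(1)[of p] by auto
qed

context
  fixes w r :: "'i::finite \<Rightarrow> real" and v s :: "'j::finite \<Rightarrow> real"
  assumes w: "admissible w r" and v: "admissible v s"
begin

lemma bvp_separation:
  assumes "bvp w r v s p q" "bvp w r v s p' q'"
  shows "p \<in> cell n \<Longrightarrow> p' \<in> cell n \<Longrightarrow> p = p' \<or> \<bar>p - p'\<bar> < \<bar>q - q'\<bar>"
    and "q \<in> cell m \<Longrightarrow> q' \<in> cell m \<Longrightarrow> q = q' \<or> \<bar>q - q'\<bar> < \<bar>p - p'\<bar>"
  using bc_separation[OF w, of p q p' q' n] bc_separation[OF v, of q p q' p' m] assms
  unfolding bvp_def by blast+

text \<open>If the solutions differed, each of the two phase differences would be strictly smaller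
  than the other.\<close>

lemma bvp_unique:
  assumes "bvp w r v s p q" "bvp w r v s p' q'"
    and "p \<in> cell n" "p' \<in> cell n" "q \<in> cell m" "q' \<in> cell m"
  shows "p = p'" "q = q'"
  using bvp_separation(1)[OF assms(1,2), of n] bvp_separation(2)[OF assms(1,2), of m] assms(3-) by auto

text \<open>With both starting phases in one cell, \<open>p\<close> changes by less than
  \<open>q\<close>, and \<open>q\<close> moves to the right.\<close>

lemma bvp_mono_right:
  assumes "bvp w r v s p q" "bvp w r v s p' q'"
    and "p \<in> cell n" "p' \<in> cell n" "q \<in> cell m" "q' \<in> cell m'" "m < m'"
  shows "q - p < q' - p'"
  using bvp_separation(1)[OF assms(1,2), of n] assms(3-) cell_less[of q m q' m'] by auto

lemma bvp_mono_left:
  assumes "bvp w r v s p q" "bvp w r v s p' q'"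
    and "p \<in> cell n" "p' \<in> cell n'" "q \<in> cell m" "q' \<in> cell m" "n' < n"
  shows "q - p < q' - p'"
  using bvp_separation(2)[OF assms(1,2), of m] assms(3-) cell_less[of p' n' p n] by auto

lemma bvp_shift:
  assumes "bvp w r v s p q"
  shows "bvp w r v s (p + 2 * h * of_int j) (q + 2 * h * of_int j)"
proof -
  have e: "osc (x + 2 * h * of_int j + c * ((y + 2 * h * of_int j) - (x + 2 * h * of_int j))) = osc (x + c * (y - x))" for x y c
    using osc_periodic(1)[of "x + c * (y - x)" j] by (simp add: algebra_simps)
  show ?thesis using assms by (simp only: bvp_def bc_def e osc_periodic(1))
qed

text \<open>A zero \<open>z\<close> of \<open>osc\<close> gives the degenerate solution
  \<open>(z, z)\<close>, and uniqueness leaves no other. This excludes solutions with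
  \<open>p < q\<close> and no critical point in between.\<close>

lemma bvp_diagonal:
  assumes "bvp w r v s p q" "p \<in> cell n" "q \<in> cell n"
  shows "p = q"
proof -
  obtain z where "z \<in> cell n" and z0: "osc z = 0" using osc_zero_in_cell by blast
  moreover have "bvp w r v s z z" using z0 by (simp add: bvp_def bc_def)
  ultimately show ?thesis using bvp_unique[OF assms(1) _ assms(2) _ assms(3)] by metis
qed

lemma bvp_cells:
  assumes "bvp w r v s p q" "p < q"
  obtains n m where "p \<in> cell n" "q \<in> cell m" "n < m"
proof -
  have "osc' p \<noteq> 0" "osc' q \<noteq> 0" using assms bc_osc'_ne_0 w v by (auto simp: bvp_def)
  then obtain n m where nm: "p \<in> cell n" "q \<in> cell m"
    using node_or_cell[of p] node_or_cell[of q] osc'_node by metis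
  moreover have "n \<noteq> m" using bvp_diagonal[OF assms(1)] nm assms(2) by blast
  moreover have "\<not> m < n" using cell_less[of q m p n] nm assms(2) by auto
  ultimately show ?thesis using that by force
qed

end

subsection \<open>Solutions on the interval\<close>

text \<open>The intermediate value theorem on \<open>[0, h]\<close> finds a phase with value
  \<open>y\<close>; the energy fixes \<open>osc'\<close> up to sign, and reflection reaches the
  other sign.\<close>

lemma osc_surj:
  assumes "z\<^sup>2 + potential y = 1"
  obtains p where "osc p = y" "osc' p = z"
proof -
  have le: "potential y \<le> 1" using assms zero_le_power2[of z] by linarith
  have 1: "y \<le> 1 / sqrt a"
  proof (cases "y \<ge> 0")
    case True
    then have "(sqrt a * y)\<^sup>2 \<le> 1\<^sup>2" using le a_pos by (simp add: potential_def power_mult_distrib)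
    then have "sqrt a * y \<le> 1" by (rule power2_le_imp_le) simp
    then show ?thesis using a_pos by (simp add: field_simps)
  next
    case False
    then show ?thesis using a_pos by (simp add: order_trans[of y 0])
  qed
  have 2: "- 1 / sqrt b \<le> y"
  proof (cases "y \<le> 0")
    case True
    then have "(sqrt b * - y)\<^sup>2 \<le> 1\<^sup>2" using le b_pos by (simp add: potential_def power_mult_distrib)
    then have "sqrt b * - y \<le> 1" by (rule power2_le_imp_le) simp
    then show ?thesis using b_pos by (simp add: field_simps)
  next
    case False
    then show ?thesis using b_pos by (simp add: order_trans[of _ 0])
  qed
  have "\<exists>p\<ge>0. p \<le> h \<and> osc p = y"
    using 1 2 h_pos osc_0 osc_h by (intro IVT2' osc_continuous) auto
  then obtain p where p: "osc p = y" by auto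
  have "(osc' p)\<^sup>2 = z\<^sup>2" using osc_energy[of p] assms p by simp
  then consider "osc' p = z" | "osc' (- p) = z" by (auto simp: power2_eq_iff osc_minus)
  then show ?thesis using that p osc_minus(1) by cases metis+
qed

lemma restoring_force_scale: "C \<ge> 0 \<Longrightarrow> restoring_force (C * y) = C * restoring_force y"
proof -
  assume C: "C \<ge> 0"
  have "max (C * y) 0 = C * max y 0" "max (- (C * y)) 0 = C * max (- y) 0"
    using C max_mult_distrib_left[of C y 0] max_mult_distrib_left[of C "- y" 0] by auto
  then show ?thesis by (simp add: restoring_force_def algebra_simps)
qed

lemma restoring_force_lipschitz: "\<bar>restoring_force y - restoring_force z\<bar> \<le> (a + b) * \<bar>y - z\<bar>"
proof -
  have "\<bar>restoring_force y - restoring_force z\<bar> =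
      \<bar>a * (max y 0 - max z 0) + b * (max (- z) 0 - max (- y) 0)\<bar>"
    by (simp add: restoring_force_def algebra_simps)
  also have "\<dots> \<le> a * \<bar>max y 0 - max z 0\<bar> + b * \<bar>max (- z) 0 - max (- y) 0\<bar>"
    using a_pos b_pos by (intro order_trans[OF abs_triangle_ineq]) (simp add: abs_mult)
  also have "\<dots> \<le> a * \<bar>y - z\<bar> + b * \<bar>y - z\<bar>"
    using a_pos b_pos by (intro add_mono mult_left_mono) auto
  finally show ?thesis by (simp add: algebra_simps)
qed

lemma restoring_force_ne_0: "y \<noteq> 0 \<Longrightarrow> restoring_force y \<noteq> 0"
  using a_pos b_pos by (auto simp: restoring_force_def max_def)

definition represented :: "(real \<Rightarrow> real) \<Rightarrow> real \<Rightarrow> real \<Rightarrow> real \<Rightarrow> bool" where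
  "represented u C p q \<longleftrightarrow> C > 0 \<and> p < q \<and> (\<forall>x\<in>{-1..1}. u x = C * osc (p + (1 + x) / 2 * (q - p)))"

text \<open>Each differentiation brings out a factor \<open>(q - p) / 2\<close>, whose square
  becomes the half-eigenvalue.\<close>

lemma profile_DERIV:
  "((\<lambda>x. C * osc (p + (1 + x) / 2 * (q - p))) has_real_derivative
     C * ((q - p) / 2) * osc' (p + (1 + x) / 2 * (q - p))) (at x)"
  "((\<lambda>x. C * ((q - p) / 2) * osc' (p + (1 + x) / 2 * (q - p))) has_real_derivative
     - (C * ((q - p) / 2)\<^sup>2 * restoring_force (osc (p + (1 + x) / 2 * (q - p))))) (at x)"
proof -
  have lin: "((\<lambda>x. p + (1 + x) / 2 * (q - p)) has_real_derivative (q - p) / 2) (at x)"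
    by (auto intro!: derivative_eq_intros)
  show "((\<lambda>x. C * osc (p + (1 + x) / 2 * (q - p))) has_real_derivative
     C * ((q - p) / 2) * osc' (p + (1 + x) / 2 * (q - p))) (at x)"
    by (rule DERIV_cong[OF DERIV_cmult[OF DERIV_chain2[OF osc_DERIV lin]]]) simp
  show "((\<lambda>x. C * ((q - p) / 2) * osc' (p + (1 + x) / 2 * (q - p))) has_real_derivative
     - (C * ((q - p) / 2)\<^sup>2 * restoring_force (osc (p + (1 + x) / 2 * (q - p))))) (at x)"
    by (rule DERIV_cong[OF DERIV_cmult[OF DERIV_chain2[OF osc'_DERIV lin]]]) (simp add: power2_eq_square)
qed

lemma represented_dI:
  assumes "represented u C p q" "x \<in> {-1..1}"
  shows "dI u x = C * ((q - p) / 2) * osc' (p + (1 + x) / 2 * (q - p))"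
    and "dI (dI u) x = - (C * ((q - p) / 2)\<^sup>2 * restoring_force (osc (p + (1 + x) / 2 * (q - p))))"
    and "(u has_real_derivative C * ((q - p) / 2) * osc' (p + (1 + x) / 2 * (q - p))) (at x within {-1..1})"
    and "(dI u has_real_derivative - (C * ((q - p) / 2)\<^sup>2 * restoring_force (osc (p + (1 + x) / 2 * (q - p)))))
       (at x within {-1..1})"
proof -
  have u: "u t = C * osc (p + (1 + t) / 2 * (q - p))" if "t \<in> {-1..1}" for t
    using assms(1) that by (auto simp: represented_def)
  note 1 = dI_eqI[OF _ u profile_DERIV(1)]
  note 2 = dI_eqI[OF _ 1(2) profile_DERIV(2)]
  show "dI u x = C * ((q - p) / 2) * osc' (p + (1 + x) / 2 * (q - p))"
    and "dI (dI u) x = - (C * ((q - p) / 2)\<^sup>2 * restoring_force (osc (p + (1 + x) / 2 * (q - p))))"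
    and "(u has_real_derivative C * ((q - p) / 2) * osc' (p + (1 + x) / 2 * (q - p))) (at x within {-1..1})"
    and "(dI u has_real_derivative - (C * ((q - p) / 2)\<^sup>2 * restoring_force (osc (p + (1 + x) / 2 * (q - p)))))
       (at x within {-1..1})"
    using 1 2 assms(2) by blast+
qed

lemma represented_C2:
  assumes "represented u C p q"
  shows "u \<in> C2_I"
proof -
  have "continuous_on {-1..1} (\<lambda>x. - (C * ((q - p) / 2)\<^sup>2 * restoring_force (osc (p + (1 + x) / 2 * (q - p)))))"
    unfolding restoring_force_def
    by (intro continuous_intros continuous_on_compose2[OF osc_continuous[of UNIV]]) auto
  then have "continuous_on {-1..1} (dI (dI u))"
    by (rule continuous_on_eq) (use represented_dI(2)[OF assms] in simp)
  then show ?thesis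
    using represented_dI(3,4)[OF assms]
    unfolding C2_I_def differentiable_on_def real_differentiable_def by blast
qed

end

section \<open>The multi-point problem\<close>

locale multipoint_problem = asymmetric_oscillator a b for a b +
  fixes \<alpha>m \<eta>m :: "real ^ 'm" and \<alpha>p \<eta>p :: "real ^ 'p"
  assumes A: "\<alpha>m \<in> A_plus" "\<alpha>p \<in> A_plus"
    and \<eta>: "\<And>i. \<eta>m $ i \<in> {-1<..<1}" "\<And>j. \<eta>p $ j \<in> {-1<..<1}"
begin

definition sol :: "real \<Rightarrow> real \<Rightarrow> bool" where
  "sol = bvp (\<lambda>i. \<alpha>m $ i) (\<lambda>i. (1 + \<eta>m $ i) / 2) (\<lambda>j. \<alpha>p $ j) (\<lambda>j. (1 - \<eta>p $ j) / 2)"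

lemma adm: "admissible (\<lambda>i. \<alpha>m $ i) (\<lambda>i. (1 + \<eta>m $ i) / 2)"
  "admissible (\<lambda>j. \<alpha>p $ j) (\<lambda>j. (1 - \<eta>p $ j) / 2)"
proof -
  have "0 \<le> (1 + \<eta>m $ i) / 2 \<and> (1 + \<eta>m $ i) / 2 \<le> 1" for i
    using \<eta>(1)[of i] by simp
  moreover have "0 \<le> (1 - \<eta>p $ i) / 2 \<and> (1 - \<eta>p $ i) / 2 \<le> 1" for i
    using \<eta>(2)[of i] by simp
  ultimately show "admissible (\<lambda>i. \<alpha>m $ i) (\<lambda>i. (1 + \<eta>m $ i) / 2)"
    "admissible (\<lambda>j. \<alpha>p $ j) (\<lambda>j. (1 - \<eta>p $ j) / 2)"
    using A unfolding admissible_def A_plus_def by blast+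
qed

section \<open>From phases to half-eigenfunctions\<close>

lemma represented_X_space_iff:
  assumes rep: "represented u C p q"
  shows "u \<in> X_space \<alpha>m \<eta>m \<alpha>p \<eta>p \<longleftrightarrow> sol p q"
proof -
  have C: "C > 0" using rep by (simp add: represented_def)
  have u: "u t = C * osc (p + (1 + t) / 2 * (q - p))" if "t \<in> {-1..1}" for t
    using rep that by (auto simp: represented_def)
  have um: "u (\<eta>m $ i) = C * osc (p + (1 + \<eta>m $ i) / 2 * (q - p))" for i
    using \<eta>(1)[of i] by (intro u) auto
  \<comment> \<open>Measured from the end 1, the inner points take the form that \<open>bc\<close>
    expects with \<open>p\<close> and \<open>q\<close> exchanged.\<close>
  have flip: "p + (1 + x) / 2 * (q - p) = q + (1 - x) / 2 * (p - q)" for x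
    by (simp add: field_simps)
  have up: "u (\<eta>p $ j) = C * osc (q + (1 - \<eta>p $ j) / 2 * (p - q))" for j
    using \<eta>(2)[of j] unfolding flip[symmetric] by (intro u) auto
  have "u (-1) - (\<Sum>i\<in>UNIV. \<alpha>m $ i * u (\<eta>m $ i)) = C * bc (\<lambda>i. \<alpha>m $ i) (\<lambda>i. (1 + \<eta>m $ i) / 2) p q"
    by (simp add: u[of "-1"] um bc_def sum_distrib_left right_diff_distrib mult.left_commute)
  moreover have "u 1 - (\<Sum>j\<in>UNIV. \<alpha>p $ j * u (\<eta>p $ j)) = C * bc (\<lambda>j. \<alpha>p $ j) (\<lambda>j. (1 - \<eta>p $ j) / 2) q p"
    by (simp add: u[of 1] up bc_def sum_distrib_left right_diff_distrib mult.left_commute)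
  ultimately show ?thesis
    using C represented_C2[OF rep] by (auto simp: X_space_def sol_def bvp_def)
qed

lemma represented_half_eigenfunction:
  assumes rep: "represented u C p q" and sol: "sol p q"
  shows "half_eigenfunction \<alpha>m \<eta>m \<alpha>p \<eta>p a b (((q - p) / 2)\<^sup>2) u"
  unfolding half_eigenfunction_def
proof (intro conjI ballI)
  have C: "C > 0" "p < q" using rep by (auto simp: represented_def)
  have u: "u t = C * osc (p + (1 + t) / 2 * (q - p))" if "t \<in> {-1..1}" for t
    using rep that by (auto simp: represented_def)
  show "u \<in> X_space \<alpha>m \<eta>m \<alpha>p \<eta>p" using represented_X_space_iff[OF rep] sol by simp
  show "\<exists>x\<in>{-1..1}. u x \<noteq> 0"
  \<comment> \<open>If \<open>u\<close> vanished on \<open>[-1,1]\<close>, \<open>p\<close> would be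
    a critical point of \<open>osc\<close>, which the condition at -1 forbids.\<close>
  proof (rule ccontr)
    assume "\<not> ?thesis"
    then have "dI u (-1) = 0" by (intro dI_eqI(2)[of _ _ "\<lambda>_. 0"]) auto
    then have "osc' p = 0" using represented_dI(1)[OF rep, of "-1"] C by simp
    then show False using bc_osc'_ne_0[OF adm(1)] sol by (auto simp: sol_def bvp_def)
  qed
  fix x :: real assume "x \<in> {-1<..<1}"
  then have x: "x \<in> {-1..1}" by simp
  show "- dI (dI u) x = ((q - p) / 2)\<^sup>2 * (a * max (u x) 0 - b * max (- u x) 0)"
    using represented_dI(2)[OF rep x] C
    by (simp add: u[OF x] restoring_force_scale flip: restoring_force_def)
qed

text \<open>Critical points of \<open>u\<close> correspond to multiples of \<open>h\<close> strictly
  between \<open>p\<close> and \<open>q\<close>. Since \<open>n * h\<close> lies left of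
  \<open>p\<close> and \<open>(m + 1) * h\<close> right of \<open>q\<close>, the indices run from
  \<open>n + 1\<close> to \<open>m\<close>.\<close>

lemma represented_zeros:
  assumes rep: "represented u C p q" and cell: "p \<in> cell n" "q \<in> cell m"
  shows "interior_zeros (dI u) = (\<lambda>j. 2 * (of_int j * h - p) / (q - p) - 1) ` {n + 1..m}"
proof -
  have C: "C > 0" "p < q" using rep by (auto simp: represented_def)
  have pq: "of_int j * h \<in> {p<..<q} \<longleftrightarrow> j \<in> {n + 1..m}" for j
  proof -
    have le: "of_int i * h \<le> of_int j * h \<longleftrightarrow> i \<le> j" for i j using h_pos by simp
    have b: "of_int n * h < p" "p < of_int (n + 1) * h" "of_int m * h < q" "q < of_int (m + 1) * h"
      using cell by (simp_all add: cell_def)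
    show ?thesis
    proof
      assume "of_int j * h \<in> {p<..<q}"
      then have "\<not> of_int j * h \<le> of_int n * h" "\<not> of_int (m + 1) * h \<le> of_int j * h" using b by auto
      then show "j \<in> {n + 1..m}" unfolding le by auto
    next
      assume "j \<in> {n + 1..m}"
      then have "of_int (n + 1) * h \<le> of_int j * h" "of_int j * h \<le> of_int m * h" unfolding le by auto
      then show "of_int j * h \<in> {p<..<q}" using b by auto
    qed
  qed
  have conv: "p + (1 + x) / 2 * (q - p) = t \<longleftrightarrow> x = 2 * (t - p) / (q - p) - 1" for x t
    using C(2) by (auto simp: field_simps)
  have mem: "2 * (t - p) / (q - p) - 1 \<in> {-1<..<1} \<longleftrightarrow> t \<in> {p<..<q}" for t
    using C(2) by (auto simp: field_simps)
  have "x \<in> interior_zeros (dI u) \<longleftrightarrow> (\<exists>j. x \<in> {-1<..<1} \<and> x = 2 * (of_int j * h - p) / (q - p) - 1)" for x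
  proof -
    have "dI u x = 0 \<longleftrightarrow> (\<exists>j. x = 2 * (of_int j * h - p) / (q - p) - 1)" if "x \<in> {-1<..<1}"
    proof -
      have "dI u x = C * ((q - p) / 2) * osc' (p + (1 + x) / 2 * (q - p))"
        using represented_dI(1)[OF rep, of x] that by simp
      moreover have "C * ((q - p) / 2) \<noteq> 0" using C by simp
      ultimately show ?thesis unfolding conv[symmetric] osc'_eq_0_iff[symmetric] by (metis mult_eq_0_iff)
    qed
    then show ?thesis by (auto simp: interior_zeros_def)
  qed
  then show ?thesis using mem pq by (auto simp only: image_iff) metis+
qed

lemma represented_T_set:
  assumes rep: "represented u C p q" and sol: "sol p q" and cell: "p \<in> cell n" "q \<in> cell m" "n < m"
  shows "u \<in> T_set \<alpha>m \<eta>m \<alpha>p \<eta>p (nat (m - n)) (- parity n)"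
proof -
  define pos where "pos j = 2 * (of_int j * h - p) / (q - p) - 1" for j :: int
  have C: "C > 0" "p < q" using rep by (auto simp: represented_def)
  have zeros: "interior_zeros (dI u) = pos ` {n + 1..m}"
    using represented_zeros[OF rep cell(1,2)] by (simp add: pos_def[abs_def])
  have mono: "pos i < pos j \<longleftrightarrow> i < j" for i j
    using C(2) h_pos by (auto simp: pos_def divide_less_cancel)
  have inj: "inj_on pos {n + 1..m}"
    using mono by (intro linorder_inj_onI') (metis less_irrefl)
  have ends: "osc' p \<noteq> 0" "osc' q \<noteq> 0"
    using bc_osc'_ne_0[OF adm(1)] bc_osc'_ne_0[OF adm(2)] sol by (auto simp: sol_def bvp_def)
  have I: "pos j \<in> {-1<..<1}" if "j \<in> {n + 1..m}" for j
    using zeros that by (auto simp: interior_zeros_def)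
  have at: "p + (1 + (2 * (t - p) / (q - p) - 1)) / 2 * (q - p) = t" for t
    using C(2) by (simp add: field_simps)
  show ?thesis
    unfolding T_set_def
  proof (intro CollectI conjI ballI impI)
    show "u \<in> X_space \<alpha>m \<eta>m \<alpha>p \<eta>p" using represented_X_space_iff[OF rep] sol by simp
    show "dI u (-1) \<noteq> 0" "dI u 1 \<noteq> 0"
      using represented_dI(1)[OF rep, of "-1"] represented_dI(1)[OF rep, of 1] C ends by auto
    \<comment> \<open>\<open>osc'\<close> is negative on cells of even index, hence the minus sign
      in \<open>- parity n\<close>.\<close>
    have "- parity n * dI u (- 1) = C * ((q - p) / 2) * - (parity n * osc' p)"
      using represented_dI(1)[OF rep, of "-1"] by simp
    also have "\<dots> > 0"
      using osc'_sign[OF cell(1)] C by (intro mult_pos_pos) auto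
    finally show "0 < - parity n * dI u (- 1)" .
    show "finite (interior_zeros (dI u))" unfolding zeros by simp
    show "card (interior_zeros (dI u)) = nat (m - n)"
      unfolding zeros using card_image[OF inj] by simp
  next
    fix x assume "x \<in> interior_zeros (dI u)"
    then obtain j where j: "j \<in> {n + 1..m}" "x = pos j" using zeros by auto
    have "dI (dI u) x = - (C * ((q - p) / 2)\<^sup>2 * restoring_force (osc (of_int j * h)))"
      using represented_dI(2)[OF rep, of x] I[OF j(1)] j(2) at[of "of_int j * h"] by (simp add: pos_def)
    moreover have "restoring_force (osc (of_int j * h)) \<noteq> 0"
      using osc_ne_0[OF osc'_node] restoring_force_ne_0 by blast
    ultimately show "simple_zero (dI u) x"
      using \<open>x \<in> interior_zeros (dI u)\<close> C by (auto simp: simple_zero_def interior_zeros_def)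
  next
    fix x y assume xy: "x \<in> interior_zeros (dI u)" "y \<in> interior_zeros (dI u)"
      "x < y \<and> {x<..<y} \<inter> interior_zeros (dI u) = {}"
    obtain i j where ij: "i \<in> {n + 1..m}" "x = pos i" "j \<in> {n + 1..m}" "y = pos j"
      using xy zeros by auto
    then have "i < j" using xy mono by auto
    \<comment> \<open>\<open>cell i\<close> starts at the critical point belonging to
      \<open>x\<close> and ends no later than the one belonging to \<open>y\<close>, so its zero of
      \<open>osc\<close> lies between them.\<close>
    obtain z where z: "z \<in> cell i" "osc z = 0" using osc_zero_in_cell by blast
    define t where "t = 2 * (z - p) / (q - p) - 1"
    have "x < t" using z C h_pos by (auto simp: ij t_def pos_def cell_def divide_less_cancel)
    moreover have "z < of_int j * h"
    proof -
      have "of_int (i + 1) * h \<le> of_int j * h" using \<open>i < j\<close> h_pos by (intro mult_right_mono) auto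
      then show ?thesis using z by (auto simp: cell_def)
    qed
    then have "t < y" using C by (auto simp: ij t_def pos_def divide_less_cancel)
    moreover have "u t = 0"
    proof -
      have "t \<in> {-1..1}" using I[OF ij(1)] I[OF ij(3)] ij \<open>x < t\<close> \<open>t < y\<close> by auto
      then have "u t = C * osc (p + (1 + t) / 2 * (q - p))" using rep by (auto simp: represented_def)
      then show ?thesis using z(2) at[of z] by (simp add: t_def)
    qed
    ultimately show "\<exists>z\<in>{x<..<y}. u z = 0" by auto
  qed
qed

section \<open>From half-eigenfunctions to phases\<close>

lemma half_eigenvalue_positive:
  assumes "half_eigenfunction \<alpha>m \<eta>m \<alpha>p \<eta>p a b \<mu> u"
  shows "\<mu> > 0"
proof (rule ccontr)
  assume "\<not> \<mu> > 0"
  have C2: "u \<in> C2_I" and bc: "u (-1) = (\<Sum>i\<in>UNIV. \<alpha>m $ i * u (\<eta>m $ i))" "u 1 = (\<Sum>i\<in>UNIV. \<alpha>p $ i * u (\<eta>p $ i))"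
    and ode: "\<And>x. x \<in> {-1<..<1} \<Longrightarrow> - dI (dI u) x = \<mu> * (a * max (u x) 0 - b * max (- u x) 0)"
    using assms unfolding half_eigenfunction_def X_space_def by blast+
  note C2 = C2_I_facts[OF C2]
  \<comment> \<open>For \<open>\<mu> \<le> 0\<close> both \<open>u\<close> and \<open>- u\<close>
    are convex where they are positive, so the maximum principle bounds both by 0.\<close>
  have "u x \<le> 0" if "x \<in> {-1..1}" for x
  proof (rule multipoint_max_principle[OF C2(1,3,4) _ A \<eta> bc that])
    fix x :: real assume x: "x \<in> {-1<..<1}" "0 < u x"
    have "\<mu> * (a * u x) \<le> 0" using \<open>\<not> \<mu> > 0\<close> x a_pos by (simp add: mult_le_0_iff)
    then show "0 \<le> dI (dI u) x" using ode[OF x(1)] x(2) by simp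
  qed
  moreover have "- u x \<le> 0" if "x \<in> {-1..1}" for x
  proof (rule multipoint_max_principle[OF _ _ _ _ A \<eta> _ _ that])
    show "continuous_on {-1..1} (\<lambda>x. - u x)" by (intro continuous_intros C2)
    show "((\<lambda>x. - u x) has_real_derivative - dI u x) (at x)"
      "((\<lambda>x. - dI u x) has_real_derivative - dI (dI u) x) (at x)" if "x \<in> {-1<..<1}" for x
      using that by (auto intro!: DERIV_minus C2)
    show "- u (-1) = (\<Sum>i\<in>UNIV. \<alpha>m $ i * - u (\<eta>m $ i))" "- u 1 = (\<Sum>i\<in>UNIV. \<alpha>p $ i * - u (\<eta>p $ i))"
      by (simp_all add: bc sum_negf)
    fix x :: real assume x: "x \<in> {-1<..<1}" "0 < - u x"
    have "\<mu> * (b * - u x) \<le> 0" using \<open>\<not> \<mu> > 0\<close> x b_pos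
      by (metis linorder_not_less mult_nonneg_nonneg mult_nonpos_nonneg order_less_imp_le)
    then show "0 \<le> - dI (dI u) x" using ode[OF x(1)] x(2) by simp
  qed
  ultimately have "u x = 0" if "x \<in> {-1..1}" for x using that by force
  then show False using assms by (auto simp: half_eigenfunction_def)
qed

text \<open>Dividing by the square root of the energy at -1 makes the initial data those of
  \<open>osc\<close> at some phase; the rescaled oscillator solves the same initial value problem,
  and uniqueness identifies it with \<open>u\<close>.\<close>

lemma half_eigenfunction_represented:
  assumes eig: "half_eigenfunction \<alpha>m \<eta>m \<alpha>p \<eta>p a b \<mu> u"
  obtains C p q n m where "represented u C p q" "sol p q" "p \<in> cell n" "q \<in> cell m" "n < m"
    "n \<in> {-1, 0}" "\<mu> = ((q - p) / 2)\<^sup>2"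
proof -
  have X: "u \<in> X_space \<alpha>m \<eta>m \<alpha>p \<eta>p" and C2: "u \<in> C2_I"
    and ode: "\<And>x. x \<in> {-1<..<1} \<Longrightarrow> - dI (dI u) x = \<mu> * restoring_force (u x)"
    and nontriv: "\<exists>x\<in>{-1..1}. u x \<noteq> 0"
    using eig unfolding half_eigenfunction_def X_space_def restoring_force_def by blast+
  note C2 = C2_I_facts[OF C2]
  have der: "(dI u has_real_derivative - \<mu> * restoring_force (u x)) (at x)" if "x \<in> {-1<..<1}" for x
    using C2(4)[OF that] ode[OF that] by (simp add: minus_equation_iff[of "dI (dI u) x"])
  have \<mu>: "\<mu> > 0" using half_eigenvalue_positive[OF eig] .
  have lip: "\<bar>- \<mu> * restoring_force y - - \<mu> * restoring_force z\<bar> \<le> (\<mu> * (a + b)) * \<bar>y - z\<bar>" for y z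
  proof -
    have "- \<mu> * restoring_force y - - \<mu> * restoring_force z = \<mu> * (restoring_force z - restoring_force y)"
      by (simp add: algebra_simps)
    then show ?thesis
      using restoring_force_lipschitz[of z y] \<mu> by (simp add: abs_mult mult.assoc abs_minus_commute)
  qed
  define s where "s = sqrt \<mu>"
  have s: "s > 0" "s\<^sup>2 = \<mu>" using \<mu> by (auto simp: s_def)
  \<comment> \<open>Energy of \<open>u\<close> at -1 in time rescaled by \<open>s\<close>; zero
    energy means zero initial data and hence the trivial solution.\<close>
  define E where "E = (dI u (-1) / s)\<^sup>2 + potential (u (-1))"
  have pot: "potential y \<ge> 0" "potential y = 0 \<longleftrightarrow> y = 0" for y
    using a_pos b_pos by (auto simp: potential_def add_nonneg_eq_0_iff max_def)
  have "E \<noteq> 0"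
  proof
    assume "E = 0"
    then have "u (-1) = 0" "dI u (-1) = 0"
      using pot[of "u (-1)"] s by (auto simp: E_def add_nonneg_eq_0_iff)
    then have "u x = 0" if "x \<in> {-1..1}" for x
      by (intro second_order_ode_unique[OF C2(1) _ C2(2) _ C2(3) _ der _ lip _ _ that, where v = "\<lambda>_. 0" and v' = "\<lambda>_. 0"])
         (auto simp: restoring_force_def)
    then show False using nontriv by auto
  qed
  then have "E > 0" using pot(1)[of "u (-1)"] by (simp add: E_def order_less_le add_nonneg_nonneg)
  define C where "C = sqrt E"
  have C: "C > 0" "C\<^sup>2 = E" using \<open>E > 0\<close> by (auto simp: C_def)
  have pot_C: "potential (u (-1) / C) = potential (u (-1)) / C\<^sup>2"
  proof -
    have "max (u (-1) / C) 0 = max (u (-1)) 0 / C" "max (- (u (-1) / C)) 0 = max (- u (-1)) 0 / C"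
      using C(1) by (auto simp: max_def field_simps)
    then show ?thesis by (simp add: potential_def power_divide add_divide_distrib)
  qed
  have "(dI u (-1) / (C * s))\<^sup>2 + potential (u (-1) / C) = 1"
  proof -
    have "(dI u (-1) / (C * s))\<^sup>2 = (dI u (-1) / s)\<^sup>2 / C\<^sup>2" by (simp add: power_divide power_mult_distrib)
    then have "(dI u (-1) / (C * s))\<^sup>2 + potential (u (-1) / C) = E / C\<^sup>2"
      by (simp only: pot_C E_def add_divide_distrib)
    then show ?thesis using C \<open>E > 0\<close> by simp
  qed
  then obtain p0 where p0: "osc p0 = u (-1) / C" "osc' p0 = dI u (-1) / (C * s)" by (rule osc_surj)
  \<comment> \<open>Removing \<open>N\<close> periods, that is \<open>2 * N\<close> cells, turns the
    cell index \<open>\<lfloor>p0 / h\<rfloor>\<close> into -1 if it is odd and 0 if it is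
    even.\<close>
  define N where "N = (\<lfloor>p0 / h\<rfloor> + 1) div 2"
  define p where "p = p0 + 2 * h * of_int (- N)"
  have p: "C * osc p = u (-1)" "C * s * osc' p = dI u (-1)"
    using p0 C s osc_periodic[of p0 "- N"] by (auto simp: p_def)
  \<comment> \<open>The interval has length 2 and the phase advances at speed
    \<open>s\<close>.\<close>
  define q where "q = p + 2 * s"
  have qp: "p < q" "(q - p) / 2 = s" using s by (auto simp: q_def)
  have rep: "represented u C p q"
    unfolding represented_def
  proof (intro conjI ballI)
    fix x :: real assume x: "x \<in> {-1..1}"
    show "u x = C * osc (p + (1 + x) / 2 * (q - p))"
    proof (rule second_order_ode_unique[OF C2(1) _ C2(2) _ C2(3) _ der _ lip _ _ x])
      show d1: "((\<lambda>x. C * osc (p + (1 + x) / 2 * (q - p))) has_real_derivative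
        C * s * osc' (p + (1 + x) / 2 * (q - p))) (at x)" for x
        using profile_DERIV(1)[of C p q x] by (simp only: qp)
      show d2: "((\<lambda>x. C * s * osc' (p + (1 + x) / 2 * (q - p))) has_real_derivative
        - \<mu> * restoring_force (C * osc (p + (1 + x) / 2 * (q - p)))) (at x)" for x
        by (rule DERIV_cong[OF profile_DERIV(2)[of C q p x, unfolded qp(2)]])
           (use C s in \<open>simp add: restoring_force_scale mult_ac\<close>)
      show "continuous_on {-1..1} (\<lambda>x. C * osc (p + (1 + x) / 2 * (q - p)))"
        "continuous_on {-1..1} (\<lambda>x. C * s * osc' (p + (1 + x) / 2 * (q - p)))"
        by (rule DERIV_continuous_on, rule has_field_derivative_at_within, rule d1 d2)+
    qed (use p in simp_all)
  qed (use C qp in simp_all)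
  then have "sol p q" using represented_X_space_iff X by blast
  obtain n m where nm: "p \<in> cell n" "q \<in> cell m" "n < m"
    using bvp_cells[OF adm] \<open>sol p q\<close> \<open>p < q\<close> unfolding sol_def by blast
  have "p0 \<in> cell (n + 2 * N)"
    using cell_shift[of p "2 * N" n] nm(1) by (simp add: p_def mult.left_commute mult.commute)
  moreover have "p0 \<noteq> of_int \<lfloor>p0 / h\<rfloor> * h"
    using osc'_sign[OF calculation] osc'_node by (metis less_irrefl mult_zero_right)
  ultimately have "\<lfloor>p0 / h\<rfloor> = n + 2 * N" using node_or_cell[of p0] cell_unique by blast
  then have "n \<in> {-1, 0}" unfolding N_def by auto
  then show ?thesis using that rep \<open>sol p q\<close> nm qp s by blast
qed

section \<open>Phase widths and their monotonicity\<close>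

lemma sol_ex: "\<exists>pq. fst pq \<in> cell n \<and> snd pq \<in> cell m \<and> sol (fst pq) (snd pq)"
  using bvp_ex[OF adm, of n m] unfolding sol_def by fastforce

text \<open>For \<open>n < m\<close> this is twice the square root of a half-eigenvalue; existence
  and uniqueness of the phases in two given cells make it well defined.\<close>

definition width :: "int \<Rightarrow> int \<Rightarrow> real" where
  "width n m = (THE d. \<exists>p\<in>cell n. \<exists>q\<in>cell m. sol p q \<and> d = q - p)"

lemma width_eqI:
  assumes "sol p q" "p \<in> cell n" "q \<in> cell m"
  shows "width n m = q - p"
  unfolding width_def
proof (rule the_equality)
  fix d assume "\<exists>p\<in>cell n. \<exists>q\<in>cell m. sol p q \<and> d = q - p"
  then show "d = q - p" using bvp_unique[OF adm] assms unfolding sol_def by metis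
qed (use assms in auto)

lemma width_cases:
  obtains p q where "sol p q" "p \<in> cell n" "q \<in> cell m" "width n m = q - p"
  using sol_ex width_eqI by blast

lemma width_mono_right: "m < m' \<Longrightarrow> width n m < width n m'"
  by (rule width_cases[of n m], rule width_cases[of n m'])
     (use bvp_mono_right[OF adm] in \<open>simp add: sol_def\<close>)

lemma width_mono_left: "n' < n \<Longrightarrow> width n m < width n' m"
  by (rule width_cases[of n m], rule width_cases[of n' m])
     (use bvp_mono_left[OF adm] in \<open>simp add: sol_def\<close>)

lemma width_shift: "width (n + 2) (m + 2) = width n m"
proof -
  obtain p q where pq: "sol p q" "p \<in> cell n" "q \<in> cell m" "width n m = q - p" by (rule width_cases)
  have "sol (p + 2 * h) (q + 2 * h)"
    using bvp_shift[OF adm, of p q 1] pq by (simp add: sol_def)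
  moreover have "p + 2 * h \<in> cell (n + 2)" "q + 2 * h \<in> cell (m + 2)"
    using cell_shift[of p 2 n] cell_shift[of q 2 m] pq by (simp_all add: mult.commute)
  ultimately show ?thesis using width_eqI pq(4) by fastforce
qed

lemma width_gt: "(of_int (m - n) - 1) * h < width n m"
  by (rule width_cases[of n m]) (auto simp: cell_def algebra_simps)

lemma width_pos: "n < m \<Longrightarrow> 0 < width n m"
proof -
  assume "n < m"
  then have "0 \<le> (of_int (m - n) - 1) * h" using h_pos by (intro mult_nonneg_nonneg) auto
  then show ?thesis using width_gt[of m n] by linarith
qed

text \<open>Moving the right cell to the right or the left cell to the left widens the phase
  interval. Different starting cells are compared through an intermediate pair of cells; the step in
  the right cell is an equality when \<open>k' = k + 1\<close>.\<close>

lemma width_less: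
  assumes "k < k'" "n \<in> {-1, 0}" "n' \<in> {-1, 0}"
  shows "width n (n + k) < width n' (n' + k')"
proof -
  consider "n = n'" | "n = 0" "n' = -1" | "n = -1" "n' = 0" using assms by auto
  then show ?thesis
  proof cases
    case 1
    then show ?thesis using assms by (auto intro: width_mono_right)
  next
    case 2
    have "width 0 k < width (-1) k" by (rule width_mono_left) simp
    also have "\<dots> \<le> width (-1) (-1 + k')"
      using width_mono_right[of k "-1 + k'" "-1"] assms by (cases "k = -1 + k'") auto
    finally show ?thesis using 2 by simp
  next
    case 3
    \<comment> \<open>A shift by one period turns the starting cell -1 into 1, which lies to the
      right of the cell 0.\<close>
    have "width (-1) (-1 + k) = width 1 (k + 1)" using width_shift[of "-1" "-1 + k"] by (simp add: add.commute)
    also have "\<dots> < width 0 (k + 1)" by (rule width_mono_left) simp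
    also have "\<dots> \<le> width 0 k'"
      using width_mono_right[of "k + 1" k' 0] assms by (cases "k + 1 = k'") auto
    finally show ?thesis using 3 by simp
  qed
qed

text \<open>
  \<open>osc\<close> increases on \<open>cell (-1)\<close> and decreases on \<open>cell 0\<close>; by periodicity the phase at \<open>-1\<close> may be
  taken in one of these.
\<close>

definition start_cell :: "real \<Rightarrow> int" where
  "start_cell \<nu> = (if \<nu> = 1 then -1 else 0)"

definition lam :: "nat \<Rightarrow> real \<Rightarrow> real" where
  "lam k \<nu> = (width (start_cell \<nu>) (start_cell \<nu> + int k) / 2)\<^sup>2"

lemma start_cell: "start_cell \<nu> \<in> {-1, 0}" "\<nu> \<in> {1, -1} \<Longrightarrow> - parity (start_cell \<nu>) = \<nu>"
    "n \<in> {-1, 0} \<Longrightarrow> start_cell (- parity n) = n"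
  by (auto simp: start_cell_def parity_def)

lemma parity_cases: "- parity n \<in> {1, -1}" by (simp add: parity_def)

lemma lam_pos: "k \<ge> 1 \<Longrightarrow> lam k \<nu> > 0"
  using width_pos[of "start_cell \<nu>" "start_cell \<nu> + int k"] by (simp add: lam_def)

lemma lam_less: "1 \<le> k \<Longrightarrow> k < k' \<Longrightarrow> lam k \<nu> < lam k' \<nu>'"
  using width_less[of "int k" "int k'" "start_cell \<nu>" "start_cell \<nu>'"]
    width_pos[of "start_cell \<nu>" "start_cell \<nu> + int k"] start_cell(1)
  unfolding lam_def by (intro power_strict_mono) auto

text \<open>Serves twice: no half-eigenvalue is missed, and together with
  \<open>T_set_disjoint\<close> each class belongs to a single one.\<close>

lemma half_eigenfunction_T_set:
  assumes "half_eigenfunction \<alpha>m \<eta>m \<alpha>p \<eta>p a b \<mu> u"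
  obtains k \<nu> where "k \<ge> 1" "\<nu> \<in> {1, -1}" "\<mu> = lam k \<nu>" "u \<in> T_set \<alpha>m \<eta>m \<alpha>p \<eta>p k \<nu>"
proof -
  obtain C p q n m where *: "represented u C p q" "sol p q" "p \<in> cell n" "q \<in> cell m" "n < m"
    "n \<in> {-1, 0}" "\<mu> = ((q - p) / 2)\<^sup>2"
    using half_eigenfunction_represented[OF assms] by blast
  show ?thesis
  proof (rule that[of "nat (m - n)" "- parity n"])
    show "\<mu> = lam (nat (m - n)) (- parity n)"
      using * width_eqI[of p q n m] start_cell(3)[of n] by (simp add: lam_def)
    show "u \<in> T_set \<alpha>m \<eta>m \<alpha>p \<eta>p (nat (m - n)) (- parity n)"
      using represented_T_set * by blast
  qed (use * parity_cases in auto)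
qed

lemma T_set_disjoint:
  assumes "u \<in> T_set \<alpha>m \<eta>m \<alpha>p \<eta>p k \<nu>" "u \<in> T_set \<alpha>m \<eta>m \<alpha>p \<eta>p k' \<nu>'" "\<nu> \<in> {1, -1}" "\<nu>' \<in> {1, -1}"
  shows "k = k'" "\<nu> = \<nu>'"
  using assms by (auto simp: T_set_def)

lemma lam_half_eigenfunction:
  assumes "k \<ge> 1" "\<nu> \<in> {1, -1}"
  shows "\<exists>u\<in>T_set \<alpha>m \<eta>m \<alpha>p \<eta>p k \<nu>. half_eigenfunction \<alpha>m \<eta>m \<alpha>p \<eta>p a b (lam k \<nu>) u"
proof -
  define n m where "n = start_cell \<nu>" and "m = n + int k"
  obtain p q where pq: "sol p q" "p \<in> cell n" "q \<in> cell m" "width n m = q - p" by (rule width_cases)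
  have nm: "n < m" using assms by (simp add: m_def)
  define u where "u x = 1 * osc (p + (1 + x) / 2 * (q - p))" for x
  have rep: "represented u 1 p q"
    using cell_less[OF pq(2,3) nm] by (simp add: represented_def u_def)
  have "u \<in> T_set \<alpha>m \<eta>m \<alpha>p \<eta>p k \<nu>"
    using represented_T_set[OF rep pq(1-3) nm] start_cell(2)[OF assms(2)] by (simp add: n_def m_def)
  moreover have "half_eigenfunction \<alpha>m \<eta>m \<alpha>p \<eta>p a b (lam k \<nu>) u"
    using represented_half_eigenfunction[OF rep pq(1)] pq(4) by (simp add: lam_def n_def m_def)
  ultimately show ?thesis by blast
qed

text \<open>By \<open>width_gt\<close> the widths grow at least linearly in \<open>k\<close>, with
  slope \<open>h\<close>.\<close>

lemma lam_unbounded: "filterlim (\<lambda>k. lam k \<nu>) at_top sequentially"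
proof -
  have "filterlim (\<lambda>k. (h / 2) * (-1 + real k)) at_top sequentially"
    using h_pos
    by (intro filterlim_tendsto_pos_mult_at_top[OF tendsto_const]
        filterlim_tendsto_add_at_top[OF tendsto_const] filterlim_real_sequentially) simp
  then have "filterlim (\<lambda>k. width (start_cell \<nu>) (start_cell \<nu> + int k) / 2) at_top sequentially"
  proof (rule filterlim_at_top_mono)
    show "\<forall>\<^sub>F k in sequentially. h / 2 * (- 1 + real k) \<le> width (start_cell \<nu>) (start_cell \<nu> + int k) / 2"
    proof (intro always_eventually allI)
      show "h / 2 * (- 1 + real k) \<le> width (start_cell \<nu>) (start_cell \<nu> + int k) / 2" for k
        using width_gt[of "start_cell \<nu> + int k" "start_cell \<nu>"] by (simp add: algebra_simps)
    qed
  qed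
  then show ?thesis unfolding lam_def by (intro filterlim_pow_at_top) simp
qed

end

theorem theorem3p1:
  fixes \<alpha>m \<eta>m :: "real ^ 'm" and \<alpha>p \<eta>p :: "real ^ 'p" and a b :: real
  assumes "a > 0" and "b > 0"
    and "\<alpha>m \<in> A_plus" and "\<alpha>p \<in> A_plus"
    and "\<forall>i. \<eta>m $ i \<in> {-1<..<1}" and "\<forall>i. \<eta>p $ i \<in> {-1<..<1}"
  shows "\<exists>lam :: nat \<Rightarrow> real \<Rightarrow> real.
      (\<forall>k\<ge>1. \<forall>\<nu>\<in>{1, -1}. lam k \<nu> > 0 \<and>
         (\<forall>\<mu>. (\<exists>u\<in>T_set \<alpha>m \<eta>m \<alpha>p \<eta>p k \<nu>. half_eigenfunction \<alpha>m \<eta>m \<alpha>p \<eta>p a b \<mu> u)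
               \<longleftrightarrow> \<mu> = lam k \<nu>))
    \<and> (\<forall>\<mu>. half_eigenvalue \<alpha>m \<eta>m \<alpha>p \<eta>p a b \<mu> \<longrightarrow> (\<exists>k\<ge>1. \<exists>\<nu>\<in>{1, -1}. \<mu> = lam k \<nu>))
    \<and> (\<forall>k\<ge>1. \<forall>k'>k. \<forall>\<nu>\<in>{1, -1}. \<forall>\<nu>'\<in>{1, -1}. lam k' \<nu>' > lam k \<nu>)
    \<and> (\<forall>\<nu>\<in>{1, -1}. \<forall>u\<in>T_set \<alpha>m \<eta>m \<alpha>p \<eta>p 1 \<nu>.
         half_eigenfunction \<alpha>m \<eta>m \<alpha>p \<eta>p a b (lam 1 \<nu>) u \<longrightarrow> (\<forall>x\<in>{-1<..<1}. \<nu> * u x > 0))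
    \<and> (\<forall>\<nu>\<in>{1, -1}. filterlim (\<lambda>k. lam k \<nu>) at_top sequentially)"
proof -
  interpret multipoint_problem a b \<alpha>m \<eta>m \<alpha>p \<eta>p
    by unfold_locales (use assms in auto)
  show ?thesis
  proof (rule exI[of _ lam], intro conjI allI impI ballI iffI)
    fix k \<nu> \<mu> assume k: "(1::nat) \<le> k" and \<nu>: "\<nu> \<in> {1, -1 :: real}"
    show "lam k \<nu> > 0" using lam_pos[OF k] .
    show "\<exists>u\<in>T_set \<alpha>m \<eta>m \<alpha>p \<eta>p k \<nu>. half_eigenfunction \<alpha>m \<eta>m \<alpha>p \<eta>p a b \<mu> u" if "\<mu> = lam k \<nu>"
      using lam_half_eigenfunction[OF k \<nu>] that by simp
    assume "\<exists>u\<in>T_set \<alpha>m \<eta>m \<alpha>p \<eta>p k \<nu>. half_eigenfunction \<alpha>m \<eta>m \<alpha>p \<eta>p a b \<mu> u"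
    then obtain u where u: "u \<in> T_set \<alpha>m \<eta>m \<alpha>p \<eta>p k \<nu>" "half_eigenfunction \<alpha>m \<eta>m \<alpha>p \<eta>p a b \<mu> u" by blast
    \<comment> \<open>The function \<open>u\<close> then lies in two of the disjoint classes, so
      their indices coincide.\<close>
    obtain k' \<nu>' where "\<nu>' \<in> {1, -1}" "\<mu> = lam k' \<nu>'" "u \<in> T_set \<alpha>m \<eta>m \<alpha>p \<eta>p k' \<nu>'"
      using half_eigenfunction_T_set[OF u(2)] by blast
    then show "\<mu> = lam k \<nu>" using T_set_disjoint[OF u(1) _ \<nu>] by blast
  next
    fix \<mu> assume "half_eigenvalue \<alpha>m \<eta>m \<alpha>p \<eta>p a b \<mu>"
    then show "\<exists>k\<ge>1. \<exists>\<nu>\<in>{1, -1}. \<mu> = lam k \<nu>"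
      unfolding half_eigenvalue_def using half_eigenfunction_T_set by metis
  next
    fix k k' :: nat and \<nu> \<nu>' :: real assume "1 \<le> k" "k < k'"
    then show "lam k \<nu> < lam k' \<nu>'" by (rule lam_less)
  next
    fix \<nu> u x assume "u \<in> T_set \<alpha>m \<eta>m \<alpha>p \<eta>p 1 \<nu>" "x \<in> {-1<..<1 :: real}"
    then show "\<nu> * u x > 0" using T_set_1_positive[OF A \<eta>] by blast
  next
    fix \<nu> show "filterlim (\<lambda>k. lam k \<nu>) at_top sequentially" by (rule lam_unbounded)
  qed
qed

end
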